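(* Let $n\ge 1$ and let $P\in\mathcal{P}^n$. Then $$\mathrm{vol}(P)\ \geq\ \frac{n\,\mathrm{G}(\mathrm{int}\,P)+1}{n!},$$ and the bound is best possible for any number of interior lattice points, i.e., for every integer $l\ge 0$ there is a polytope $P\in\mathcal{P}^n$ with $\mathrm{G}(\mathrm{int}\,P)=l$ and $\mathrm{vol}(P)=(n\,l+1)/n!$. Moreover, for $P\in\mathcal{P}^n$ with $\mathrm{G}(\mathrm{int}\,P)=1$, equality holds if and only if $P$ is unimodularly isomorphic to the simplex $S_n(1)=\mathrm{conv}\{e_1,\dots,e_n,-\sum_{i=1}^n e_i\}$.
   Context: $\mathcal{P}^n$ is the set of all convex lattice $n$-polytopes in $\mathbb{R}^n$ with respect to $\mathbb{Z}^n$: all vertices of $P$ lie in $\mathbb{Z}^n$ and $\dim P=n$. For $S\subset\mathbb{R}^n$, $\mathrm{G}(S)=\#(S\cap\mathbb{Z}^n)$. $\mathrm{int}$ denotes the interior, $\mathrm{vol}$ the $n$-dimensional Lebesgue measure, $e_i$ the $i$-th unit vector. Two lattice polytopes are unimodularly isomorphic (equivalent) if one is the image of the other under a map $x\mapsto Ax+b$ with $A\in GL_n(\mathbb{Z})$ and $b\in\mathbb{Z}^n$. *)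

theory Defs
  imports "HOL-Analysis.Analysis"
begin

definition int_lattice :: "(real ^ 'n) set" where
  "int_lattice = {x. \<forall>i. x $ i \<in> \<int>}"

definition lattice_polytopes :: "(real ^ 'n) set set" where
  "lattice_polytopes =
     {P. polytope P \<and> {v. v extreme_point_of P} \<subseteq> int_lattice \<and> aff_dim P = int CARD('n)}"

(* Meaningful for bounded S only, since card of an infinite set is 0. *)
definition lattice_count :: "(real ^ 'n) set \<Rightarrow> nat" where
  "lattice_count S = card (S \<inter> int_lattice)"

(* Invertibility is taken over the integers, so A ranges over GL_n(Z). *)
definition unimodularly_isomorphic :: "(real ^ 'n) set \<Rightarrow> (real ^ 'n) set \<Rightarrow> bool" where
  "unimodularly_isomorphic P Q \<longleftrightarrow>
     (\<exists>(A :: int ^ 'n ^ 'n) b. invertible A \<and> b \<in> int_lattice \<and>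
        P = (\<lambda>x. map_matrix real_of_int A *v x + b) ` Q)"

definition S1_simplex :: "(real ^ 'n) set" where
  "S1_simplex = convex hull (insert (- (\<Sum>i\<in>UNIV. axis i 1)) (range (\<lambda>i. axis i 1)))"

end

theory Submission
  imports Defs
begin

text \<open>
  The proof counts simplices. Suppose that a lattice polytope \<open>P\<close> is covered by finitely many
  full-dimensional lattice simplices whose volumes add up to at most \<open>vol P\<close>. The volume of a
  lattice simplex is the absolute value of an integer determinant divided by \<open>n!\<close>, hence at least
  \<open>1/n!\<close>, and so \<open>vol P\<close> is at least the number of simplices divided by \<open>n!\<close>. It remains to find such
  a dissection with \<open>n l + 1\<close> simplices, where \<open>l\<close> is the number of interior lattice points.

  The start is a dissection that uses no vertices but those of \<open>P\<close> (\<open>dissection_exists\<close>): lift the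
  vertices to generic heights and keep the simplices whose affine interpolant of the heights lies
  below all the lifted points. It contains at least one simplex. Then the interior lattice points
  are inserted one by one. Inserting \<open>p\<close> replaces every simplex that contains \<open>p\<close> by the cones from
  \<open>p\<close> over those of its facets that miss \<open>p\<close>; a simplex whose smallest face containing \<open>p\<close> has
  dimension \<open>k\<close> turns into \<open>k + 1\<close> simplices. The main point is that these dimensions add up to at
  least \<open>n\<close> (\<open>sum_carrier_dim_ge\<close>). If they did not, there would be few simplices around \<open>p\<close>, each
  with many facets through \<open>p\<close>; one could choose one such facet from each simplex so that the normals
  are linearly independent, and then some direction would leave all the simplices at once, although
  they cover a neighbourhood of \<open>p\<close>. Hence every interior lattice point contributes at least \<open>n\<close> new
  simplices.

  The bound is attained by the simplices with vertices \<open>e_1, ..., e_n, -l (e_1 + ... + e_n)\<close>, whose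
  interior lattice points are \<open>-k (1, ..., 1)\<close> with \<open>0 \<le> k < l\<close>. If \<open>l = 1\<close> and equality holds, then the
  dissection after inserting the interior point \<open>p\<close> has exactly \<open>n + 1\<close> simplices, so that the initial
  one consisted of \<open>P\<close> alone. The \<open>n + 1\<close> pieces each have volume at least \<open>1/n!\<close> and together
  \<open>(n + 1)/n!\<close>; therefore all the barycentric coordinates of \<open>p\<close> are \<open>1/(n + 1)\<close>, and the vectors from
  \<open>p\<close> to any \<open>n\<close> of the vertices form a basis of the lattice. In this basis, with origin \<open>p\<close>, the
  polytope is \<open>S_n(1)\<close>.
\<close>

section \<open>Linear images and the volume of a simplex\<close>

text \<open>
  The index type carries no order here, so the shears cannot be treated as triangular matrices.
  Instead every linear map is decomposed into elementary maps: a shear is a row operation and a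
  transposition is a row permutation of the identity matrix.
\<close>

lemma measure_linear_image_finite_index:
  fixes f :: "real^'n \<Rightarrow> real^'n"
  assumes "linear f" "S \<in> lmeasurable"
  shows "f ` S \<in> lmeasurable \<and> measure lebesgue (f ` S) = \<bar>det (matrix f)\<bar> * measure lebesgue S"
proof -
  let ?\<mu> = "measure lebesgue :: (real^'n) set \<Rightarrow> real"
  \<comment> \<open>An elementary map of determinant 1 or -1 only has to be checked on boxes.\<close>
  have unit: "\<forall>S\<in>lmeasurable. g ` S \<in> lmeasurable \<and> ?\<mu> (g ` S) = \<bar>det (matrix g)\<bar> * ?\<mu> S"
    if "linear g" "\<bar>det (matrix g)\<bar> = 1" "\<And>a b. cbox a b \<noteq> {} \<Longrightarrow> ?\<mu> (g ` cbox a b) = ?\<mu> (cbox a b)"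
    for g :: "real^'n \<Rightarrow> real^'n"
  proof
    fix S :: "(real^'n) set" assume "S \<in> lmeasurable"
    moreover have "?\<mu> (g ` cbox a b) = 1 * ?\<mu> (cbox a b)" for a b
      using that(3)[of a b] by (cases "cbox a b = {}") auto
    ultimately show "g ` S \<in> lmeasurable \<and> ?\<mu> (g ` S) = \<bar>det (matrix g)\<bar> * ?\<mu> S"
      using measure_linear_sufficient[OF that(1), of S 1] that(2) by simp
  qed
  have "\<forall>S\<in>lmeasurable. f ` S \<in> lmeasurable \<and> ?\<mu> (f ` S) = \<bar>det (matrix f)\<bar> * ?\<mu> S"
    using \<open>linear f\<close>
  proof (rule induct_linear_elementary)
    fix f g :: "real^'n \<Rightarrow> real^'n"
    assume lin: "linear f" "linear g"
      and f: "\<forall>S\<in>lmeasurable. f ` S \<in> lmeasurable \<and> ?\<mu> (f ` S) = \<bar>det (matrix f)\<bar> * ?\<mu> S"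
      and g: "\<forall>S\<in>lmeasurable. g ` S \<in> lmeasurable \<and> ?\<mu> (g ` S) = \<bar>det (matrix g)\<bar> * ?\<mu> S"
    show "\<forall>S\<in>lmeasurable. (f \<circ> g) ` S \<in> lmeasurable \<and> ?\<mu> ((f \<circ> g) ` S) = \<bar>det (matrix (f \<circ> g))\<bar> * ?\<mu> S"
    proof
      fix S :: "(real^'n) set" assume S: "S \<in> lmeasurable"
      then have gS: "g ` S \<in> lmeasurable"
        using g by blast
      then show "(f \<circ> g) ` S \<in> lmeasurable \<and> ?\<mu> ((f \<circ> g) ` S) = \<bar>det (matrix (f \<circ> g))\<bar> * ?\<mu> S"
        unfolding matrix_compose[OF lin(2,1)] image_comp[symmetric]
        using f[THEN bspec, OF gS] g[THEN bspec, OF S] by (simp only: det_mul abs_mult mult.assoc simp_thms)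
    qed
  next
    fix f :: "real^'n \<Rightarrow> real^'n" and i
    assume lin: "linear f" and 0: "\<And>x. f x $ i = 0"
    have "f x \<noteq> axis i 1" for x
      using 0[of x] by (metis axis_nth one_neq_zero)
    then have "\<not> surj f"
      by (metis surjD)
    then have ninj: "\<not> inj f"
      using lin linear_injective_imp_surjective by blast
    then have "det (matrix f) = 0"
      using det_nz_iff_inj[OF lin] by blast
    then show "\<forall>S\<in>lmeasurable. f ` S \<in> lmeasurable \<and> ?\<mu> (f ` S) = \<bar>det (matrix f)\<bar> * ?\<mu> S"
      using negligible_linear_singular_image[OF lin ninj] by (simp add: negligible_iff_measure)
  next
    fix c :: "'n \<Rightarrow> real"
    have "det (matrix (\<lambda>x. \<chi> i. c i * x $ i)) = prod c UNIV"
      by (subst det_diagonal) (auto simp: matrix_def axis_def)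
    then show "\<forall>S\<in>lmeasurable. (\<lambda>x. \<chi> i. c i * x $ i) ` S \<in> lmeasurable
        \<and> ?\<mu> ((\<lambda>x. \<chi> i. c i * x $ i) ` S) = \<bar>det (matrix (\<lambda>x. \<chi> i. c i * x $ i))\<bar> * ?\<mu> S"
      by (simp add: measure_stretch measurable_stretch)
  next
    fix m n :: 'n
    assume "m \<noteq> n"
    let ?t = "Transposition.transpose m n"
    let ?h = "\<lambda>x::real^'n. \<chi> i. x $ ?t i"
    have lin: "linear ?h"
      by (rule linearI) (simp_all add: vec_eq_iff)
    have perm: "?t permutes UNIV"
      by (simp add: permutes_swap_id)
    have mat: "matrix ?h = (\<chi> i. mat 1 $ ?t i)"
      by (simp add: matrix_def vec_eq_iff mat_def axis_def)
    have det: "\<bar>det (matrix ?h)\<bar> = 1"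
      unfolding mat det_permute_rows[OF perm] using \<open>m \<noteq> n\<close> by (simp add: sign_swap_id)
    have "?\<mu> (?h ` cbox a b) = ?\<mu> (cbox a b)" if ne: "cbox a b \<noteq> {}" for a b
    proof -
      have eq: "?h ` cbox a b = cbox (?h a) (?h b)"
      proof (intro equalityI subsetI)
        fix y assume y: "y \<in> cbox (?h a) (?h b)"
        have "a $ i \<le> y $ ?t i \<and> y $ ?t i \<le> b $ i" for i
          using y[unfolded mem_box_cart, rule_format, of "?t i"] by simp
        then have "?h y \<in> cbox a b"
          by (simp add: mem_box_cart)
        moreover have "?h (?h y) = y"
          by (simp add: vec_eq_iff)
        ultimately show "y \<in> ?h ` cbox a b"
          by (metis imageI)
      qed (auto simp: mem_box_cart)
      moreover have "cbox (?h a) (?h b) \<noteq> {}"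
        using ne unfolding eq[symmetric] by simp
      moreover have "(\<Prod>i\<in>UNIV. (b - a) $ ?t i) = (\<Prod>i\<in>UNIV. (b - a) $ i)"
        by (rule prod.permute[OF perm, unfolded o_def, symmetric])
      ultimately show ?thesis
        using ne eq by (simp add: content_cbox_cart)
    qed
    with lin det show "\<forall>S\<in>lmeasurable. ?h ` S \<in> lmeasurable \<and> ?\<mu> (?h ` S) = \<bar>det (matrix ?h)\<bar> * ?\<mu> S"
      by (intro unit)
  next
    fix m n :: 'n
    assume mn: "m \<noteq> n"
    let ?h = "\<lambda>x::real^'n. \<chi> i. if i = m then x $ m + x $ n else x $ i"
    have lin: "linear ?h"
      by (rule linearI) (simp_all add: vec_eq_iff algebra_simps)
    have mat: "matrix ?h = (\<chi> k. if k = m then row m (mat 1) + 1 *s row n (mat 1) else row k (mat 1))"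
      by (simp add: matrix_def vec_eq_iff mat_def axis_def row_def)
    have det: "\<bar>det (matrix ?h)\<bar> = 1"
      unfolding mat det_row_operation[OF mn] by simp
    have "?\<mu> (?h ` cbox a b) = ?\<mu> (cbox a b)" if ne: "cbox a b \<noteq> {}" for a b
    proof -
      \<comment> \<open>A translation reduces the computation to a box on which the sheared coordinate is nonnegative.\<close>
      define v where "v = axis n \<bar>a $ n\<bar>"
      have "?h ` cbox (v + a) (v + b) = (+) (?h v) ` ?h ` cbox a b"
        by (simp add: cbox_translation image_image linear_add[OF lin])
      then have "?\<mu> (?h ` cbox a b) = ?\<mu> (?h ` cbox (v + a) (v + b))"
        by (simp add: measure_translation)
      also have "\<dots> = ?\<mu> (cbox (v + a) (v + b))"
        using ne by (intro measure_shear_interval mn) (auto simp: v_def cbox_translation)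
      also have "\<dots> = ?\<mu> (cbox a b)"
        by (simp add: cbox_translation measure_translation)
      finally show ?thesis .
    qed
    with lin det show "\<forall>S\<in>lmeasurable. ?h ` S \<in> lmeasurable \<and> ?\<mu> (?h ` S) = \<bar>det (matrix ?h)\<bar> * ?\<mu> S"
      by (intro unit)
  qed
  then show ?thesis
    using assms(2) by blast
qed

text \<open>
  Such a convex hull is the image of the standard simplex under the affine map that sends the
  origin to \<open>a\<close> and the \<open>j\<close>-th unit vector to \<open>f j\<close>. For a degenerate hull both sides are 0, which lets vertices be
  replaced without case distinctions.
\<close>

lemma measure_simplex:
  fixes f :: "'n::finite \<Rightarrow> real^'n"
  shows "measure lebesgue (convex hull (insert a (range f))) = \<bar>det (\<chi> i j. f j $ i - a $ i)\<bar> / fact CARD('n)"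
proof -
  let ?M = "\<chi> i j. f j $ i - a $ i"
  let ?g = "(*v) ?M"
  let ?std = "convex hull (insert 0 Basis) :: (real^'n) set"
  have e: "?g (axis j 1) = f j - a" for j
    by (simp add: matrix_vector_mult_basis column_def vec_eq_iff)
  have cpt: "compact ?std"
    by (intro finite_imp_compact_convex_hull) auto
  have "(+) a ` ?g ` insert 0 Basis = insert a (range f)"
    by (auto simp: Basis_vec_def image_iff e)
  then have "convex hull (insert a (range f)) = (+) a ` ?g ` ?std"
    by (simp only: convex_hull_linear_image[OF matrix_vector_mul_linear] flip: convex_hull_translation)
  then have "measure lebesgue (convex hull (insert a (range f))) = measure lebesgue (?g ` ?std)"
    by (simp add: measure_translation)
  also have "\<dots> = \<bar>det ?M\<bar> * measure lebesgue ?std"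
    using measure_linear_image_finite_index[OF matrix_vector_mul_linear lmeasurable_compact[OF cpt], of ?M]
    by (simp add: matrix_of_matrix_vector_mul)
  also have "measure lebesgue ?std = 1 / fact CARD('n)"
    using content_std_simplex[where 'a="real^'n"] cpt by (simp add: compact_imp_closed)
  finally show ?thesis
    by simp
qed

section \<open>Barycentric coordinates and exchange of a vertex\<close>

text \<open>
  Simplices are represented by their vertex sets; the simplex itself is the convex hull.
\<close>

definition full_simplex :: "(real^'n) set \<Rightarrow> bool" where
  "full_simplex B \<longleftrightarrow> card B = Suc CARD('n) \<and> \<not> affine_dependent B"

text \<open>
  The barycentric coordinates with respect to a full-dimensional simplex are defined on the whole
  space. Only their values on the vertex set are determined.
\<close>

definition bary :: "(real^'n) set \<Rightarrow> real^'n \<Rightarrow> real^'n \<Rightarrow> real" where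
  "bary B x = (SOME u. sum u B = 1 \<and> (\<Sum>b\<in>B. u b *\<^sub>R b) = x)"

lemma full_simplex_finite: "full_simplex B \<Longrightarrow> finite B"
  by (simp add: full_simplex_def aff_independent_finite)

lemma bary_spec:
  fixes B :: "(real^'n) set"
  assumes "full_simplex B"
  shows bary_sum: "sum (bary B x) B = 1"
    and bary_combination: "(\<Sum>b\<in>B. bary B x b *\<^sub>R b) = x"
proof -
  have "affine hull B = UNIV"
    using assms by (intro affine_independent_span_eq) (auto simp: full_simplex_def)
  then have "\<exists>u. sum u B = 1 \<and> (\<Sum>b\<in>B. u b *\<^sub>R b) = x"
    using affine_hull_finite[OF full_simplex_finite[OF assms]] by auto
  then have "sum (bary B x) B = 1 \<and> (\<Sum>b\<in>B. bary B x b *\<^sub>R b) = x"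
    unfolding bary_def by (rule someI_ex)
  then show "sum (bary B x) B = 1" "(\<Sum>b\<in>B. bary B x b *\<^sub>R b) = x"
    by auto
qed

lemma bary_unique:
  assumes B: "full_simplex B" and u: "sum u B = 1" "(\<Sum>b\<in>B. u b *\<^sub>R b) = x" and "b \<in> B"
  shows "bary B x b = u b"
proof (rule ccontr)
  assume ne: "bary B x b \<noteq> u b"
  define d where "d c = bary B x c - u c" for c
  have "sum d B = 0" "(\<Sum>c\<in>B. d c *\<^sub>R c) = 0" "d b \<noteq> 0"
    using bary_spec[OF B, of x] u ne
    by (auto simp: d_def sum_subtractf scaleR_left_diff_distrib)
  then have "affine_dependent B"
    using affine_dependent_explicit_finite[OF full_simplex_finite[OF B]] \<open>b \<in> B\<close> by blast
  then show False
    using B by (simp add: full_simplex_def)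
qed

lemma bary_affine:
  assumes B: "full_simplex B" and "sum c I = 1" and "b \<in> B"
  shows "bary B (\<Sum>i\<in>I. c i *\<^sub>R x i) b = (\<Sum>i\<in>I. c i * bary B (x i) b)"
proof (rule bary_unique[OF B _ _ \<open>b \<in> B\<close>])
  have "(\<Sum>b\<in>B. \<Sum>i\<in>I. c i * bary B (x i) b) = (\<Sum>i\<in>I. c i * sum (bary B (x i)) B)"
    by (subst sum.swap) (simp add: sum_distrib_left)
  then show "(\<Sum>b\<in>B. \<Sum>i\<in>I. c i * bary B (x i) b) = 1"
    using assms by (simp add: bary_sum)
  have "(\<Sum>b\<in>B. (\<Sum>i\<in>I. c i * bary B (x i) b) *\<^sub>R b) = (\<Sum>i\<in>I. c i *\<^sub>R (\<Sum>b\<in>B. bary B (x i) b *\<^sub>R b))"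
    unfolding scaleR_sum_left scaleR_sum_right by (subst sum.swap) simp
  then show "(\<Sum>b\<in>B. (\<Sum>i\<in>I. c i * bary B (x i) b) *\<^sub>R b) = (\<Sum>i\<in>I. c i *\<^sub>R x i)"
    using B by (simp add: bary_combination)
qed

lemma bary_vertex:
  assumes "full_simplex B" "b \<in> B" "c \<in> B"
  shows "bary B c b = (if b = c then 1 else 0)"
proof (rule bary_unique[OF assms(1) _ _ assms(2)])
  show "(\<Sum>b\<in>B. if b = c then 1 else 0) = 1" "(\<Sum>b\<in>B. (if b = c then 1 else 0) *\<^sub>R b) = c"
    using assms full_simplex_finite[OF assms(1)] by (simp_all add: if_distrib[of "\<lambda>r. r *\<^sub>R _"] cong: if_cong)
qed

lemma mem_simplex_iff:
  assumes "full_simplex B"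
  shows "x \<in> convex hull B \<longleftrightarrow> (\<forall>b\<in>B. 0 \<le> bary B x b)"
proof -
  have "x \<in> convex hull B \<longleftrightarrow> (\<exists>u. (\<forall>b\<in>B. 0 \<le> u b) \<and> sum u B = 1 \<and> (\<Sum>b\<in>B. u b *\<^sub>R b) = x)"
    by (simp add: convex_hull_finite[OF full_simplex_finite[OF assms]])
  also have "\<dots> \<longleftrightarrow> (\<forall>b\<in>B. 0 \<le> bary B x b)"
  proof (intro iffI exI[of _ "bary B x"] conjI)
    assume "\<exists>u. (\<forall>b\<in>B. 0 \<le> u b) \<and> sum u B = 1 \<and> (\<Sum>b\<in>B. u b *\<^sub>R b) = x"
    then obtain u where u: "\<forall>b\<in>B. 0 \<le> u b" "sum u B = 1" "(\<Sum>b\<in>B. u b *\<^sub>R b) = x"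
      by blast
    then show "\<forall>b\<in>B. 0 \<le> bary B x b"
      using bary_unique[OF assms u(2,3)] by simp
  qed (auto simp: bary_spec[OF assms])
  finally show ?thesis .
qed

lemma mem_interior_simplex_iff:
  fixes B :: "(real^'n) set"
  assumes "full_simplex B"
  shows "x \<in> interior (convex hull B) \<longleftrightarrow> (\<forall>b\<in>B. 0 < bary B x b)"
proof -
  have *: "\<not> affine_dependent B" "\<not> card B \<le> DIM(real^'n)"
    using assms by (auto simp: full_simplex_def)
  have "interior (convex hull B) = {y. \<exists>u. (\<forall>x\<in>B. 0 < u x) \<and> sum u B = 1 \<and> (\<Sum>x\<in>B. u x *\<^sub>R x) = y}"
    by (rule trans[OF interior_convex_hull_explicit_minimal[OF *(1)] if_not_P[OF *(2)]])
  then have "x \<in> interior (convex hull B) \<longleftrightarrow> (\<exists>u. (\<forall>b\<in>B. 0 < u b) \<and> sum u B = 1 \<and> (\<Sum>b\<in>B. u b *\<^sub>R b) = x)"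
    by simp
  also have "\<dots> \<longleftrightarrow> (\<forall>b\<in>B. 0 < bary B x b)"
  proof (intro iffI exI[of _ "bary B x"] conjI)
    assume "\<exists>u. (\<forall>b\<in>B. 0 < u b) \<and> sum u B = 1 \<and> (\<Sum>b\<in>B. u b *\<^sub>R b) = x"
    then obtain u where u: "\<forall>b\<in>B. 0 < u b" "sum u B = 1" "(\<Sum>b\<in>B. u b *\<^sub>R b) = x"
      by blast
    then show "\<forall>b\<in>B. 0 < bary B x b"
      using bary_unique[OF assms u(2,3)] by simp
  qed (auto simp: bary_spec[OF assms])
  finally show ?thesis .
qed

lemma full_simplex_measure_pos_iff:
  fixes B :: "(real^'n) set"
  assumes "card B = Suc CARD('n)"
  shows "full_simplex B \<longleftrightarrow> 0 < measure lebesgue (convex hull B)"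
proof -
  have "finite B"
    using assms card.infinite by force
  then have "convex hull B \<in> lmeasurable"
    by (simp add: finite_imp_compact_convex_hull lmeasurable_compact)
  then have "0 < measure lebesgue (convex hull B) \<longleftrightarrow> \<not> negligible (convex hull B)"
    by (simp add: negligible_iff_measure zero_less_measure_iff)
  also have "\<dots> \<longleftrightarrow> \<not> affine_dependent B"
    using assms by (simp add: negligible_convex_interior interior_convex_hull_eq_empty)
  finally show ?thesis
    using assms by (simp add: full_simplex_def)
qed

lemma enumerate_facet:
  fixes B :: "(real^'n) set"
  assumes "full_simplex B" "a \<in> B"
  shows "\<exists>f :: 'n \<Rightarrow> real^'n. bij_betw f UNIV (B - {a})"
proof -
  have "finite (B - {a})" "card (B - {a}) = CARD('n)"
    using assms full_simplex_finite by (auto simp: full_simplex_def)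
  then show ?thesis
    by (metis finite_class.finite_UNIV finite_same_card_bij)
qed

text \<open>
  By Cramer's rule, exchanging one column of the edge matrix for the vector to \<open>w\<close> multiplies the
  determinant by the coordinate of that vector, which is a barycentric coordinate of \<open>w\<close>. The edges
  emanate from a vertex \<open>a\<close> that stays in place.
\<close>

lemma measure_replace_vertex:
  fixes B :: "(real^'n) set"
  assumes B: "full_simplex B" and b: "b \<in> B"
  shows "measure lebesgue (convex hull (insert w (B - {b}))) = \<bar>bary B w b\<bar> * measure lebesgue (convex hull B)"
proof -
  have fin: "finite B" and card: "card B = Suc CARD('n)"
    using B full_simplex_finite by (auto simp: full_simplex_def)
  have "card (B - {b}) = CARD('n)"
    using fin card b by simp
  then obtain a where a: "a \<in> B" "a \<noteq> b"
    by (metis DiffE card_gt_0_iff ex_in_conv insertCI zero_less_card_finite)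
  obtain f :: "'n \<Rightarrow> real^'n" where f: "bij_betw f UNIV (B - {a})"
    using enumerate_facet[OF B a(1)] by blast
  then obtain k where k: "f k = b"
    using a b by (metis DiffI bij_betw_imp_surj_on empty_iff imageE insert_iff)
  have inj: "f j = b \<longleftrightarrow> j = k" for j
    using f k by (auto simp: bij_betw_def inj_on_def)
  have ran: "range f = B - {a}"
    using f by (simp add: bij_betw_def)
  let ?A = "\<chi> i j. f j $ i - a $ i"
  let ?x = "\<chi> j. bary B w (f j)"
  have "w - a = (\<Sum>c\<in>B. bary B w c *\<^sub>R (c - a))"
    using bary_spec[OF B, of w] by (simp add: scaleR_right_diff_distrib sum_subtractf flip: scaleR_left.sum)
  also have "\<dots> = (\<Sum>c\<in>B - {a}. bary B w c *\<^sub>R (c - a))"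
    using fin a by (simp add: sum.remove)
  also have "\<dots> = (\<Sum>j\<in>UNIV. bary B w (f j) *\<^sub>R (f j - a))"
    by (rule sum.reindex_bij_betw[OF f, symmetric])
  finally have "?A *v ?x = w - a"
    by (simp add: vec_eq_iff matrix_vector_mult_def mult.commute)
  then have A': "(\<chi> i j. (f(k := w)) j $ i - a $ i) = (\<chi> i j. if j = k then (?A *v ?x) $ i else ?A $ i $ j)"
    by (simp add: vec_eq_iff)
  have "insert w (B - {b}) = insert a (range (f(k := w)))"
  proof -
    have "range (f(k := w)) = insert w (f ` (UNIV - {k}))"
      by (auto simp: fun_upd_image)
    also have "f ` (UNIV - {k}) = range f - {b}"
      using inj k by auto
    finally show ?thesis
      using a ran by auto
  qed
  then have "measure lebesgue (convex hull (insert w (B - {b})))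
      = \<bar>det (\<chi> i j. if j = k then (?A *v ?x) $ i else ?A $ i $ j)\<bar> / fact CARD('n)"
    by (simp only: measure_simplex A')
  also have "\<dots> = \<bar>bary B w b\<bar> * (\<bar>det ?A\<bar> / fact CARD('n))"
    unfolding cramer_lemma by (simp add: k abs_mult)
  also have "\<bar>det ?A\<bar> / fact CARD('n) = measure lebesgue (convex hull B)"
    unfolding measure_simplex[symmetric] ran using a by (simp add: insert_absorb)
  finally show ?thesis .
qed

lemma full_simplex_replace_vertex:
  fixes B :: "(real^'n) set"
  assumes B: "full_simplex B" and b: "b \<in> B" and w: "bary B w b \<noteq> 0"
  shows "full_simplex (insert w (B - {b}))" "w \<notin> B - {b}"
proof -
  show *: "w \<notin> B - {b}"
    using bary_vertex[OF B b] w by (auto split: if_splits)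
  have "card (insert w (B - {b})) = Suc CARD('n)"
    using * b B full_simplex_finite[OF B] by (simp add: full_simplex_def)
  then show "full_simplex (insert w (B - {b}))"
    using full_simplex_measure_pos_iff measure_replace_vertex[OF B b, of w] w B
    by (metis full_simplex_def mult_pos_pos zero_less_abs_iff)
qed

text \<open>
  Solve for \<open>b\<close> in the representation of \<open>w\<close>, and substitute into the representation of \<open>x\<close>.
\<close>

lemma bary_replace_vertex:
  fixes x :: "real^'n"
  assumes B: "full_simplex B" and b: "b \<in> B" and w: "bary B w b \<noteq> 0"
  defines "t \<equiv> bary B x b / bary B w b"
  shows "bary (insert w (B - {b})) x w = t"
    and "\<And>c. c \<in> B - {b} \<Longrightarrow> bary (insert w (B - {b})) x c = bary B x c - t * bary B w c"
proof -
  note B' = full_simplex_replace_vertex[OF B b w]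
  note fin = full_simplex_finite[OF B]
  define u where "u c = (if c = w then t else bary B x c - t * bary B w c)" for c
  have zero: "bary B x b - t * bary B w b = 0"
    using w by (simp add: t_def)
  have u: "(\<Sum>c\<in>B - {b}. u c) = (\<Sum>c\<in>B. bary B x c - t * bary B w c)"
    "(\<Sum>c\<in>B - {b}. u c *\<^sub>R c) = (\<Sum>c\<in>B. (bary B x c - t * bary B w c) *\<^sub>R c)"
    using B'(2) zero by (auto simp: sum.remove[OF fin b] u_def intro!: sum.cong split: if_splits)
  have "sum u (insert w (B - {b})) = t + (\<Sum>c\<in>B. bary B x c - t * bary B w c)"
    using B'(2) fin u by (simp add: u_def)
  also have "\<dots> = 1"
    by (simp add: sum_subtractf bary_sum[OF B] flip: sum_distrib_left)
  finally have 1: "sum u (insert w (B - {b})) = 1" .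
  have "(\<Sum>c\<in>insert w (B - {b}). u c *\<^sub>R c) = t *\<^sub>R w + (\<Sum>c\<in>B. (bary B x c - t * bary B w c) *\<^sub>R c)"
    using B'(2) fin u by (simp add: u_def)
  also have "\<dots> = x"
    by (simp add: sum_subtractf bary_combination[OF B] scaleR_left_diff_distrib
        flip: scaleR_scaleR scaleR_sum_right)
  finally have 2: "(\<Sum>c\<in>insert w (B - {b}). u c *\<^sub>R c) = x" .
  note * = bary_unique[OF B'(1) 1 2]
  show "bary (insert w (B - {b})) x w = t"
    using *[of w] by (simp add: u_def)
  show "bary (insert w (B - {b})) x c = bary B x c - t * bary B w c" if "c \<in> B - {b}" for c
    using *[of c] that B'(2) by (auto simp: u_def)
qed

text \<open>
  The pivot step of the simplex method: among the vertices with positive coordinate in \<open>w\<close>, the one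
  with the least ratio of coordinates can be exchanged for \<open>w\<close> without losing the point \<open>x\<close>. This one
  lemma yields both the covering by the pieces of a subdivision and the descent that finds a lower
  simplex.
\<close>

lemma exchange_vertex:
  assumes B: "full_simplex B" and x: "x \<in> convex hull B"
  obtains b where "b \<in> B" "0 < bary B w b" "x \<in> convex hull (insert w (B - {b}))"
proof -
  note fin = full_simplex_finite[OF B]
  define K where "K = {b \<in> B. 0 < bary B w b}"
  have "K \<noteq> {}"
  proof
    assume "K = {}"
    then have "sum (bary B w) B \<le> 0"
      by (intro sum_nonpos) (auto simp: K_def not_less)
    then show False
      by (simp add: bary_sum[OF B])
  qed
  moreover have "finite K"
    using fin by (simp add: K_def)
  moreover define r where "r b = bary B x b / bary B w b" for b
  ultimately have fin_r: "finite (r ` K)" and "Min (r ` K) \<in> r ` K"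
    by simp_all
  then obtain b where b: "b \<in> K" "Min (r ` K) = r b"
    by blast
  have r: "r b \<le> r c" if "c \<in> K" for c
    using Min_le[OF fin_r, of "r c"] that b(2) by simp
  define t where "t = bary B x b / bary B w b"
  have bB: "b \<in> B" "0 < bary B w b"
    using b by (auto simp: K_def)
  have x0: "0 \<le> bary B x c" if "c \<in> B" for c
    using x that mem_simplex_iff[OF B] by blast
  have t0: "0 \<le> t"
    using x0 bB by (simp add: t_def)
  have le: "t * bary B w c \<le> bary B x c" if "c \<in> B" for c
  proof (cases "0 < bary B w c")
    case True
    then have "t \<le> bary B x c / bary B w c"
      using r[of c] that by (simp add: t_def r_def K_def)
    then show ?thesis
      using True by (simp add: pos_le_divide_eq)
  next
    case False
    then have "t * bary B w c \<le> 0"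
      using t0 by (simp add: mult_nonneg_nonpos)
    then show ?thesis
      using x0[OF that] by linarith
  qed
  have w: "bary B w b \<noteq> 0"
    using bB by simp
  have "x \<in> convex hull (insert w (B - {b}))"
    unfolding mem_simplex_iff[OF full_simplex_replace_vertex(1)[OF B bB(1) w]]
    using bary_replace_vertex[OF B bB(1) w, where x=x] t0 le by (auto simp: t_def)
  with bB that show thesis
    by blast
qed

section \<open>Subdividing simplices at a point\<close>

text \<open>
  The dimension of the smallest face of the simplex that contains \<open>p\<close>, which is the number of
  additional simplices created by subdividing at \<open>p\<close>. The value 0 for a simplex that misses \<open>p\<close>
  reflects that such a simplex is left alone.
\<close>

definition carrier_dim :: "real^'n \<Rightarrow> (real^'n) set \<Rightarrow> nat" where
  "carrier_dim p B = (if p \<in> convex hull B then card {b \<in> B. 0 < bary B p b} - 1 else 0)"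

lemma star_cover:
  assumes B: "full_simplex B" and p: "p \<in> convex hull B"
  shows "(\<Union>b\<in>{b \<in> B. 0 < bary B p b}. convex hull (insert p (B - {b}))) = convex hull B"
proof (intro equalityI subsetI)
  fix x assume "x \<in> convex hull B"
  then obtain b where "b \<in> B" "0 < bary B p b" "x \<in> convex hull (insert p (B - {b}))"
    using exchange_vertex[OF B] by blast
  then show "x \<in> (\<Union>b\<in>{b \<in> B. 0 < bary B p b}. convex hull (insert p (B - {b})))"
    by blast
next
  fix x assume "x \<in> (\<Union>b\<in>{b \<in> B. 0 < bary B p b}. convex hull (insert p (B - {b})))"
  then obtain b where "x \<in> convex hull (insert p (B - {b}))"
    by blast
  moreover have "insert p (B - {b}) \<subseteq> convex hull B"
    using p hull_subset[of B convex] by auto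
  ultimately show "x \<in> convex hull B"
    by (metis convex_convex_hull subset_hull subsetD)
qed

text \<open>
  The pieces take up fractions of the volume that are the barycentric coordinates of \<open>p\<close>.
\<close>

lemma star_measure:
  assumes B: "full_simplex B" and p: "p \<in> convex hull B"
  shows "(\<Sum>b | b \<in> B \<and> 0 < bary B p b. measure lebesgue (convex hull (insert p (B - {b}))))
    = measure lebesgue (convex hull B)"
proof -
  have "(\<Sum>b | b \<in> B \<and> 0 < bary B p b. measure lebesgue (convex hull (insert p (B - {b}))))
      = (\<Sum>b | b \<in> B \<and> 0 < bary B p b. bary B p b * measure lebesgue (convex hull B))"
    by (intro sum.cong) (auto simp: measure_replace_vertex[OF B])
  also have "\<dots> = (\<Sum>b\<in>B. bary B p b * measure lebesgue (convex hull B))"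
    using p mem_simplex_iff[OF B] full_simplex_finite[OF B]
    by (intro sum.mono_neutral_left) (auto simp: not_less intro: antisym)
  finally show ?thesis
    by (simp add: bary_sum[OF B] flip: sum_distrib_right)
qed

text \<open>
  Multisets are used because the number of simplices matters: were equal vertex sets to arise from
  different simplices, a set would merge them, and excluding this would require an argument about
  disjoint interiors.
\<close>

lemma refine_at_point:
  fixes T :: "(real^'n) set multiset"
  assumes "\<forall>B\<in>#T. full_simplex B"
  shows "\<exists>T'. (\<forall>B\<in>#T'. full_simplex B \<and> B \<subseteq> insert p (\<Union>(set_mset T)))
      \<and> (\<Union>B\<in>set_mset T'. convex hull B) = (\<Union>B\<in>set_mset T. convex hull B)
      \<and> (\<Sum>B\<in>#T'. measure lebesgue (convex hull B)) = (\<Sum>B\<in>#T. measure lebesgue (convex hull B))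
      \<and> size T' = size T + (\<Sum>B\<in>#T. carrier_dim p B)"
  using assms
proof (induction T)
  case (add B T)
  then obtain T' where T': "\<forall>B\<in>#T'. full_simplex B \<and> B \<subseteq> insert p (\<Union>(set_mset T))"
      "(\<Union>B\<in>set_mset T'. convex hull B) = (\<Union>B\<in>set_mset T. convex hull B)"
      "(\<Sum>B\<in>#T'. measure lebesgue (convex hull B)) = (\<Sum>B\<in>#T. measure lebesgue (convex hull B))"
      "size T' = size T + (\<Sum>B\<in>#T. carrier_dim p B)"
    by auto
  have B: "full_simplex B"
    using add.prems by simp
  note fin = full_simplex_finite[OF B]
  show ?case
  proof (cases "p \<in> convex hull B")
    case False
    show ?thesis
      using B T' False by (intro exI[of _ "add_mset B T'"]) (auto simp: carrier_dim_def)
  next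
    case True
    define K where "K = {b \<in> B. 0 < bary B p b}"
    have fK: "finite K"
      using fin by (simp add: K_def)
    have "K \<noteq> {}"
      using exchange_vertex[OF B True, of p] by (auto simp: K_def)
    then have cK: "card K = Suc (carrier_dim p B)"
      using True fK by (simp add: carrier_dim_def K_def[symmetric] card_gt_0_iff)
    define R where "R = image_mset (\<lambda>b. insert p (B - {b})) (mset_set K)"
    have setR: "set_mset R = (\<lambda>b. insert p (B - {b})) ` K"
      using fK by (simp add: R_def)
    have "\<forall>B'\<in>#R. full_simplex B' \<and> B' \<subseteq> insert p B"
      using full_simplex_replace_vertex(1)[OF B, of _ p] by (auto simp: setR K_def)
    moreover have "(\<Union>B'\<in>set_mset R. convex hull B') = convex hull B"
      using star_cover[OF B True] by (simp add: setR K_def)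
    moreover have "(\<Sum>B'\<in>#R. measure lebesgue (convex hull B')) = measure lebesgue (convex hull B)"
      using star_measure[OF B True]
      by (simp add: R_def multiset.map_comp o_def K_def sum_unfold_sum_mset)
    moreover have "size R = Suc (carrier_dim p B)"
      by (simp add: R_def cK)
    ultimately show ?thesis
      using T' by (intro exI[of _ "R + T'"]) auto
  qed
qed auto

section \<open>The number of new simplices around an interior point\<close>

lemma bary_gradient:
  assumes B: "full_simplex B" and b: "b \<in> B"
  shows "\<exists>g. \<forall>x y. bary B y b - bary B x b = g \<bullet> (y - x)"
proof -
  define l where "l v = bary B v b - bary B 0 b" for v
  have "linear l"
  proof (rule linearI)
    fix x y
    \<comment> \<open>A sum of two vectors is an affine combination once the origin enters with weight -1.\<close>
    have "bary B (\<Sum>i\<in>{0,1,2::nat}. [1,1,-1] ! i *\<^sub>R [x,y,0] ! i) b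
        = (\<Sum>i\<in>{0,1,2::nat}. [1,1,-1] ! i * bary B ([x,y,0] ! i) b)"
      by (rule bary_affine[OF B _ b]) simp
    then show "l (x + y) = l x + l y"
      by (simp add: l_def)
  next
    fix r x
    have "bary B (\<Sum>i\<in>{0,1::nat}. [r,1-r] ! i *\<^sub>R [x,0] ! i) b
        = (\<Sum>i\<in>{0,1::nat}. [r,1-r] ! i * bary B ([x,0] ! i) b)"
      by (rule bary_affine[OF B _ b]) simp
    then show "l (r *\<^sub>R x) = r *\<^sub>R l x"
      by (simp add: l_def algebra_simps)
  qed
  then have "l v = adjoint l 1 \<bullet> v" for v
    using adjoint_works[of l v 1] by (simp add: inner_commute)
  then have "bary B y b - bary B x b = adjoint l 1 \<bullet> (y - x)" for x y
    by (metis (no_types, opaque_lifting) inner_diff_right diff_diff_eq2 diff_add_cancel l_def)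
  then show ?thesis
    by blast
qed

text \<open>
  A greedy choice works: the vectors picked so far span a space of dimension less than \<open>card (A j)\<close>, so
  some vector of the independent set \<open>A j\<close> lies outside this span.
\<close>

lemma independent_transversal:
  fixes A :: "'i \<Rightarrow> 'a::euclidean_space set"
  assumes "finite I" "\<And>i. i \<in> I \<Longrightarrow> independent (A i) \<and> card I \<le> card (A i)"
  shows "\<exists>c. (\<forall>i\<in>I. c i \<in> A i) \<and> independent (c ` I)"
  using assms
proof (induction I)
  case empty
  show ?case
    by (simp add: independent_empty)
next
  case (insert j I)
  have "independent (A i) \<and> card I \<le> card (A i)" if "i \<in> I" for i
    using insert.prems[of i] insert.hyps that by auto
  then obtain c where c: "\<forall>i\<in>I. c i \<in> A i" "independent (c ` I)"
    using insert.IH by blast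
  have Aj: "independent (A j)" "card I < card (A j)"
    using insert.prems[of j] insert.hyps by auto
  have "\<not> A j \<subseteq> span (c ` I)"
  proof
    assume "A j \<subseteq> span (c ` I)"
    then have "card (A j) \<le> dim (span (c ` I))"
      using Aj(1) independent_card_le_dim by blast
    also have "\<dots> \<le> card I"
      using dim_le_card'[of "c ` I"] card_image_le[OF insert.hyps(1), of c] insert.hyps(1) by simp
    finally show False
      using Aj(2) by simp
  qed
  then obtain v where v: "v \<in> A j" "v \<notin> span (c ` I)"
    by blast
  have "(c(j := v)) ` insert j I = insert v (c ` I)"
    using insert.hyps(2) by auto
  then have "independent ((c(j := v)) ` insert j I)"
    using c(2) v(2) by (simp add: independent_insertI)
  then show ?case
    using c(1) v(1) insert.hyps(2) by (intro exI[of _ "c(j := v)"]) auto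
qed

text \<open>
  The coordinate functions that vanish at \<open>p\<close> take the values 0 and 1 at the vertices like a dual
  basis, so evaluating a linear relation between the gradients at the vectors from \<open>p\<close> to these
  vertices isolates each coefficient.
\<close>

lemma independent_gradients:
  assumes B: "full_simplex B" and N: "N \<subseteq> {b \<in> B. bary B p b = 0}"
    and g: "\<And>b x y. b \<in> B \<Longrightarrow> bary B y b - bary B x b = g b \<bullet> (y - x)"
  shows "inj_on g N" "independent (g ` N)"
proof -
  have eval: "g b \<bullet> (c - p) = (if b = c then 1 else 0)" if "b \<in> N" "c \<in> N" for b c
  proof -
    have "b \<in> B" "c \<in> B" "bary B p b = 0"
      using that N by auto
    then show ?thesis
      using g[of b c p] bary_vertex[OF B, of b c] by simp
  qed
  show inj: "inj_on g N"
    using eval by (intro inj_onI) (metis zero_neq_one)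
  have finN: "finite N"
    using N full_simplex_finite[OF B] finite_subset by fastforce
  show "independent (g ` N)"
  proof (rule independent_if_scalars_zero)
    show "finite (g ` N)"
      using finN by simp
    fix f v assume f: "(\<Sum>v\<in>g ` N. f v *\<^sub>R v) = 0" and v: "v \<in> g ` N"
    from v obtain c where c: "c \<in> N" "v = g c"
      by blast
    have "0 = (\<Sum>b\<in>N. f (g b) *\<^sub>R g b) \<bullet> (c - p)"
      using f by (simp add: sum.reindex[OF inj])
    also have "\<dots> = (\<Sum>b\<in>N. if b = c then f (g b) else 0)"
      unfolding inner_sum_left by (intro sum.cong) (use eval c in auto)
    also have "\<dots> = f v"
      using c finN by simp
    finally show "f v = 0"
      by simp
  qed
qed

text \<open>
  If the sum were less than the dimension, then each simplex around \<open>p\<close> would have at least as many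
  facets through \<open>p\<close> as there are simplices around \<open>p\<close>. This allows the choice of one facet per simplex
  with independent normals, hence of a direction \<open>d\<close> that points strictly out of all of them. A short
  step from \<open>p\<close> along \<open>d\<close> leaves the union, although \<open>p\<close> is interior to it.
\<close>

lemma sum_carrier_dim_ge:
  fixes F :: "(real^'n) set set"
  assumes "finite F" and full: "\<And>B. B \<in> F \<Longrightarrow> full_simplex B"
    and p: "p \<in> interior (\<Union>B\<in>F. convex hull B)" and nv: "p \<notin> \<Union>F"
  shows "CARD('n) \<le> (\<Sum>B\<in>F. carrier_dim p B)"
proof (rule ccontr)
  assume less: "\<not> CARD('n) \<le> (\<Sum>B\<in>F. carrier_dim p B)"
  define G where "G = {B \<in> F. p \<in> convex hull B}"
  have finG: "finite G"
    using \<open>finite F\<close> by (simp add: G_def)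
  have "(\<Sum>B\<in>G. carrier_dim p B) = (\<Sum>B\<in>F. carrier_dim p B)"
    using \<open>finite F\<close> by (intro sum.mono_neutral_left) (auto simp: G_def carrier_dim_def)
  then have less': "(\<Sum>B\<in>G. carrier_dim p B) < CARD('n)"
    using less by simp
  define N where "N B = {b \<in> B. bary B p b = 0}" for B
  have "\<exists>g. \<forall>B\<in>G. \<forall>b\<in>B. \<forall>x y. bary B y b - bary B x b = g B b \<bullet> (y - x)"
    using full bary_gradient unfolding G_def by (metis (mono_tags, lifting) mem_Collect_eq)
  then obtain g where g: "\<And>B b x y. B \<in> G \<Longrightarrow> b \<in> B \<Longrightarrow> bary B y b - bary B x b = g B b \<bullet> (y - x)"
    by blast
  have G: "full_simplex B" "p \<in> convex hull B" "p \<notin> B" if "B \<in> G" for B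
    using that full nv by (auto simp: G_def)
  have card_N: "card (N B) + carrier_dim p B = CARD('n) \<and> 1 \<le> carrier_dim p B" if BG: "B \<in> G" for B
  proof -
    note B = G(1)[OF BG] and pB = G(2)[OF BG]
    note fin = full_simplex_finite[OF B]
    define K where "K = {b \<in> B. 0 < bary B p b}"
    have BNK: "N B \<union> K = B" "N B \<inter> K = {}"
      using pB mem_simplex_iff[OF B] by (auto simp: N_def K_def less_le)
    have "finite (N B)" and fK: "finite K"
      using fin by (simp_all add: N_def K_def)
    then have "card B = card (N B) + card K"
      using card_Un_disjoint[of "N B" K] BNK by simp
    moreover have "2 \<le> card K"
    proof (rule ccontr)
      assume "\<not> 2 \<le> card K"
      then have K1: "card K \<le> 1"
        by simp
      have "bary B p b = 0" if "b \<in> B - K" for b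
        using that BNK(1) by (auto simp: N_def)
      then have "sum (bary B p) K = sum (bary B p) B"
        "(\<Sum>b\<in>K. bary B p b *\<^sub>R b) = (\<Sum>b\<in>B. bary B p b *\<^sub>R b)"
        using fin BNK(1) by (auto intro!: sum.mono_neutral_left)
      then have sK: "sum (bary B p) K = 1" "(\<Sum>b\<in>K. bary B p b *\<^sub>R b) = p"
        by (simp_all add: bary_spec[OF B])
      then have "K \<noteq> {}"
        by auto
      then have "card K = 1"
        using K1 fK by (metis card_0_eq le_eq_less_or_eq less_one)
      then obtain b where "K = {b}"
        using card_1_singletonE by blast
      then have "p = b" "b \<in> B"
        using sK by (auto simp: K_def)
      then show False
        using G(3)[OF BG] by simp
    qed
    ultimately show ?thesis
      using B pB by (simp add: full_simplex_def carrier_dim_def K_def)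
  qed
  have "card G \<le> card (N B)" if "B \<in> G" for B
  proof -
    \<comment> \<open>As \<open>p\<close> is not a vertex, every other simplex contributes at least 1 to the sum.\<close>
    have "card (G - {B}) \<le> (\<Sum>B\<in>G - {B}. carrier_dim p B)"
      using sum_mono[of "G - {B}" "\<lambda>_. 1" "carrier_dim p"] card_N by simp
    then have "card G - 1 + carrier_dim p B < CARD('n)"
      using less' that finG by (simp add: sum.remove)
    then show ?thesis
      using card_N[OF that] by linarith
  qed
  then have "independent (g B ` N B) \<and> card G \<le> card (g B ` N B)" if "B \<in> G" for B
    using independent_gradients[OF G(1)[OF that], of "N B" p "g B"] g that
    by (simp add: N_def card_image)
  then obtain c where c: "\<forall>B\<in>G. c B \<in> g B ` N B" "independent (c ` G)"
    using independent_transversal[OF finG, of "\<lambda>B. g B ` N B"] by blast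
  obtain f where f: "linear f" "\<And>v. v \<in> c ` G \<Longrightarrow> f v = (-1::real)"
    using linear_independent_extend[OF c(2), of "\<lambda>_. -1"] by blast
  define d where "d = adjoint f 1"
  have d: "c B \<bullet> d = -1" if "B \<in> G" for B
    using adjoint_works[OF f(1), of "c B" 1] f(2) that by (simp add: d_def)
  \<comment> \<open>The simplices that miss \<open>p\<close> also miss a neighbourhood of it.\<close>
  define U where "U = interior (\<Union>B\<in>F. convex hull B) - (\<Union>B\<in>F - G. convex hull B)"
  have "closed (\<Union>B\<in>F - G. convex hull B)"
    using \<open>finite F\<close> full
    by (intro closed_UN) (auto intro!: compact_imp_closed finite_imp_compact_convex_hull full_simplex_finite)
  then have "open U"
    unfolding U_def by (intro open_Diff) auto
  moreover have "p \<in> U"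
    using p by (auto simp: U_def G_def)
  moreover have "((\<lambda>e. p + e *\<^sub>R d) \<longlongrightarrow> p + 0 *\<^sub>R d) (at_right 0)"
    by (intro tendsto_intros)
  ultimately have "eventually (\<lambda>e. p + e *\<^sub>R d \<in> U) (at_right 0)"
    by (intro topological_tendstoD) auto
  then have "eventually (\<lambda>e. p + e *\<^sub>R d \<in> U \<and> 0 < e) (at_right 0)"
    by (intro eventually_conj eventually_at_right_less)
  then obtain e where e: "p + e *\<^sub>R d \<in> U" "0 < e"
    using eventually_happens trivial_limit_at_right_real by blast
  then obtain B where B: "B \<in> G" "p + e *\<^sub>R d \<in> convex hull B"
    using interior_subset unfolding U_def by blast
  obtain b where b: "b \<in> N B" "c B = g B b"
    using c(1) B(1) by blast
  have "bary B (p + e *\<^sub>R d) b - bary B p b = - e"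
    using g[OF B(1), of b p "p + e *\<^sub>R d"] b d[OF B(1)] by (simp add: N_def)
  then have "bary B (p + e *\<^sub>R d) b < 0"
    using b(1) e(2) by (simp add: N_def)
  then show False
    using mem_simplex_iff[OF G(1)[OF B(1)], of "p + e *\<^sub>R d"] B(2) b(1) by (auto simp: N_def not_le[symmetric])
qed

section \<open>Regular dissections without new vertices\<close>

text \<open>
  Covering and the bound on the sum of the volumes together force the simplices to overlap in null
  sets only. In this form the property passes to subdivisions without any reasoning about
  intersections.
\<close>

definition dissection :: "(real^'n) set multiset \<Rightarrow> (real^'n) set \<Rightarrow> bool" where
  "dissection T P \<longleftrightarrow> (\<forall>B\<in>#T. full_simplex B) \<and> (\<Union>B\<in>set_mset T. convex hull B) = P
     \<and> (\<Sum>B\<in>#T. measure lebesgue (convex hull B)) \<le> measure lebesgue P"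

text \<open>
  The affine function that agrees with \<open>h\<close> on the vertices of the simplex.
\<close>

definition interpolant :: "(real^'n) set \<Rightarrow> (real^'n \<Rightarrow> real) \<Rightarrow> real^'n \<Rightarrow> real" where
  "interpolant B h x = (\<Sum>b\<in>B. bary B x b * h b)"

lemma interpolant_affine:
  assumes "full_simplex B" "sum c I = 1"
  shows "interpolant B h (\<Sum>i\<in>I. c i *\<^sub>R x i) = (\<Sum>i\<in>I. c i * interpolant B h (x i))"
proof -
  have "interpolant B h (\<Sum>i\<in>I. c i *\<^sub>R x i) = (\<Sum>b\<in>B. \<Sum>i\<in>I. c i * (bary B (x i) b * h b))"
    unfolding interpolant_def
    by (intro sum.cong) (simp_all add: bary_affine[OF assms] sum_distrib_right mult.assoc)
  also have "\<dots> = (\<Sum>i\<in>I. c i * interpolant B h (x i))"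
    unfolding interpolant_def by (subst sum.swap) (simp add: sum_distrib_left)
  finally show ?thesis .
qed

lemma interpolant_via:
  assumes B: "full_simplex B" and C: "full_simplex C"
  shows "interpolant B h x = (\<Sum>c\<in>C. bary C x c * interpolant B h c)"
  using interpolant_affine[OF B bary_sum[OF C, of x], of h "\<lambda>c. c"] by (simp add: bary_combination[OF C])

lemma interpolant_le:
  assumes B: "full_simplex B" and C: "full_simplex C"
    and le: "\<And>c. c \<in> C \<Longrightarrow> interpolant B h c \<le> h c" and x: "x \<in> convex hull C"
  shows "interpolant B h x \<le> interpolant C h x"
  unfolding interpolant_via[OF B C, of h x] interpolant_def[of C]
  using x le mem_simplex_iff[OF C] by (intro sum_mono mult_left_mono) auto

text \<open>
  Heights \<open>t ^ i\<close> on an enumerated set are generic for all but finitely many \<open>t\<close>: a coincidence of \<open>h w\<close>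
  with an interpolant from vertices other than \<open>w\<close> is a root of a polynomial in which the monomial
  belonging to \<open>w\<close> has coefficient 1.
\<close>

lemma generic_heights:
  fixes V :: "(real^'n) set"
  assumes "finite V"
  shows "\<exists>h. \<forall>B w. B \<subseteq> V \<longrightarrow> full_simplex B \<longrightarrow> w \<in> V - B \<longrightarrow> interpolant B h w \<noteq> h w"
proof -
  obtain idx :: "real^'n \<Rightarrow> nat" where idx: "inj_on idx V"
    using finite_imp_inj_to_nat_seg[OF assms] by blast
  define q where "q B w = monom 1 (idx w) - (\<Sum>b\<in>B. monom (bary B w b) (idx b))" for B w
  define X where "X = {(B, w). B \<subseteq> V \<and> full_simplex B \<and> w \<in> V - B}"
  have "X \<subseteq> Pow V \<times> V"
    by (auto simp: X_def)
  then have "finite X"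
    using assms finite_subset by blast
  moreover have "finite {t. poly (q B w) t = 0}" if "(B, w) \<in> X" for B w
  proof (rule poly_roots_finite)
    have "idx b \<noteq> idx w" if "b \<in> B" for b
      using idx that \<open>(B, w) \<in> X\<close> by (auto simp: X_def inj_on_def)
    then have "coeff (q B w) (idx w) = 1"
      by (simp add: q_def coeff_sum)
    then show "q B w \<noteq> 0"
      by auto
  qed
  ultimately have "finite (\<Union>(B, w)\<in>X. {t. poly (q B w) t = 0})"
    by auto
  then obtain t where t: "t \<notin> (\<Union>(B, w)\<in>X. {t. poly (q B w) t = 0})"
    using ex_new_if_finite[OF infinite_UNIV_char_0] by blast
  have "interpolant B (\<lambda>v. t ^ idx v) w \<noteq> t ^ idx w" if "B \<subseteq> V" "full_simplex B" "w \<in> V - B" for B w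
  proof -
    have "poly (q B w) t \<noteq> 0"
      using t that by (auto simp: X_def)
    then show ?thesis
      by (simp add: q_def interpolant_def poly_sum poly_monom)
  qed
  then show ?thesis
    by (intro exI[of _ "\<lambda>v. t ^ idx v"]) blast
qed

text \<open>
  The projections of the lower facets of the convex hull of the points \<open>(v, h v)\<close>; for generic heights
  they form a regular triangulation.
\<close>

definition lower_simplices :: "(real^'n) set \<Rightarrow> (real^'n \<Rightarrow> real) \<Rightarrow> (real^'n) set set" where
  "lower_simplices V h = {B. B \<subseteq> V \<and> full_simplex B \<and> (\<forall>w\<in>V. interpolant B h w \<le> h w)}"

text \<open>
  At a common interior point both interpolants give the height of the lower hull. The interpolant of
  \<open>B\<close> must then touch the heights at all vertices of \<open>C\<close>, which by genericity happens at vertices of \<open>B\<close>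
  only.
\<close>

lemma lower_simplices_disjoint:
  assumes generic: "\<And>B w. B \<subseteq> V \<Longrightarrow> full_simplex B \<Longrightarrow> w \<in> V - B \<Longrightarrow> interpolant B h w \<noteq> h w"
    and B: "B \<in> lower_simplices V h" and C: "C \<in> lower_simplices V h"
    and x: "x \<in> interior (convex hull B)" "x \<in> interior (convex hull C)"
  shows "B = C"
proof -
  have sub: "C \<subseteq> B"
    if B: "B \<in> lower_simplices V h" and C: "C \<in> lower_simplices V h"
      and xB: "x \<in> interior (convex hull B)" and xC: "x \<in> interior (convex hull C)" for B C
  proof
    fix c assume c: "c \<in> C"
    note full = B[unfolded lower_simplices_def] C[unfolded lower_simplices_def]
    have fB: "full_simplex B" and fC: "full_simplex C" and BV: "B \<subseteq> V" and CV: "C \<subseteq> V"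
      using full by auto
    have "interpolant C h x \<le> interpolant B h x"
      using full xB interior_subset by (intro interpolant_le) blast+
    then have "(\<Sum>c\<in>C. bary C x c * (h c - interpolant B h c)) \<le> 0"
      unfolding interpolant_via[OF fB fC, of h x] interpolant_def[of C]
      by (simp add: right_diff_distrib sum_subtractf)
    moreover have nonneg: "0 \<le> bary C x c * (h c - interpolant B h c)" if "c \<in> C" for c
      using that full xC mem_interior_simplex_iff[OF fC] by (intro mult_nonneg_nonneg) (auto simp: less_imp_le)
    ultimately have "bary C x c * (h c - interpolant B h c) = 0"
      using c full_simplex_finite[OF fC] sum_nonneg_eq_0_iff[of C "\<lambda>c. bary C x c * (h c - interpolant B h c)"]
        sum_nonneg[of C "\<lambda>c. bary C x c * (h c - interpolant B h c)"] by force
    then have "interpolant B h c = h c"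
      using xC c mem_interior_simplex_iff[OF fC] by force
    then show "c \<in> B"
      using generic[OF BV fB] c CV by blast
  qed
  show ?thesis
    using sub[OF B C x] sub[OF C B x(2,1)] by blast
qed

text \<open>
  Among the simplices containing \<open>x\<close>, take one whose interpolant is least at \<open>x\<close>. If some point \<open>w\<close> lay
  below this interpolant, exchanging a vertex for \<open>w\<close> would lower the value at \<open>x\<close>; the decrease is
  strict because \<open>x\<close> avoids all the lower-dimensional hulls.
\<close>

lemma lower_simplices_cover_generic:
  fixes V :: "(real^'n) set"
  assumes V: "finite V" and x: "x \<in> convex hull V"
    and gen: "\<And>W. W \<subseteq> V \<Longrightarrow> interior (convex hull W) = {} \<Longrightarrow> x \<notin> convex hull W"
  shows "\<exists>B\<in>lower_simplices V h. x \<in> convex hull B"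
proof -
  define C where "C = {B. B \<subseteq> V \<and> full_simplex B \<and> x \<in> convex hull B}"
  have "finite C"
    using V by (simp add: C_def)
  moreover have "C \<noteq> {}"
  proof -
    obtain S where S: "finite S" "S \<subseteq> V" "card S \<le> CARD('n) + 1" "x \<in> convex hull S"
      using x caratheodory[of V] by auto
    have ne: "interior (convex hull S) \<noteq> {}"
      using gen S by blast
    then have card: "card S = Suc CARD('n)"
      using S empty_interior_convex_hull[of S] by force
    then have "full_simplex S"
      using ne interior_convex_hull_eq_empty[of S] by (simp add: full_simplex_def)
    then show ?thesis
      using S by (auto simp: C_def)
  qed
  ultimately have fin: "finite ((\<lambda>B. interpolant B h x) ` C)"
    and "Min ((\<lambda>B. interpolant B h x) ` C) \<in> (\<lambda>B. interpolant B h x) ` C"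
    by simp_all
  then obtain B where BC: "B \<in> C" and Bmin: "Min ((\<lambda>B. interpolant B h x) ` C) = interpolant B h x"
    by blast
  have min: "interpolant B h x \<le> interpolant B' h x" if "B' \<in> C" for B'
    using Min_le[OF fin, of "interpolant B' h x"] that Bmin by simp
  have B: "full_simplex B" "B \<subseteq> V" "x \<in> convex hull B"
    using BC by (auto simp: C_def)
  note finB = full_simplex_finite[OF B(1)]
  have "interpolant B h w \<le> h w" if w: "w \<in> V" for w
  proof (rule ccontr)
    assume less: "\<not> interpolant B h w \<le> h w"
    obtain b where b: "b \<in> B" "0 < bary B w b" "x \<in> convex hull (insert w (B - {b}))"
      using exchange_vertex[OF B(1,3)] by blast
    have nz: "bary B w b \<noteq> 0"
      using b by simp
    define B' where "B' = insert w (B - {b})"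
    define t where "t = bary B x b / bary B w b"
    note full' = full_simplex_replace_vertex[OF B(1) b(1) nz]
    have "B' \<in> C"
      using full' b w B by (auto simp: C_def B'_def)
    have "bary B x b \<noteq> 0"
    proof
      assume 0: "bary B x b = 0"
      have "sum (bary B x) (B - {b}) = 1" "(\<Sum>c\<in>B - {b}. bary B x c *\<^sub>R c) = x"
        using bary_spec[OF B(1), of x] finB b(1) 0 by (simp_all add: sum.remove)
      then have "x \<in> convex hull (B - {b})"
        unfolding convex_hull_finite[OF finite_Diff[OF finB]]
        using B mem_simplex_iff[OF B(1)] by blast
      moreover have "interior (convex hull (B - {b})) = {}"
        using B(1) b(1) finB by (intro empty_interior_convex_hull) (auto simp: full_simplex_def)
      ultimately show False
        using gen[of "B - {b}"] B by blast
    qed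
    moreover have "0 \<le> bary B x b"
      using B b mem_simplex_iff by blast
    ultimately have "0 < t"
      using b by (simp add: t_def)
    have "interpolant B' h x = t * h w + (\<Sum>c\<in>B - {b}. (bary B x c - t * bary B w c) * h c)"
      unfolding interpolant_def B'_def using full'(2) finB bary_replace_vertex[OF B(1) b(1) nz, where x=x]
      by (simp add: t_def)
    also have "(\<Sum>c\<in>B - {b}. (bary B x c - t * bary B w c) * h c) = (\<Sum>c\<in>B. (bary B x c - t * bary B w c) * h c)"
      using nz by (simp add: sum.remove[OF finB b(1)] t_def)
    also have "\<dots> = interpolant B h x - t * interpolant B h w"
      by (simp add: interpolant_def left_diff_distrib sum_subtractf sum_distrib_left mult.assoc)
    also have "t * h w + (interpolant B h x - t * interpolant B h w) < interpolant B h x"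
      using less \<open>0 < t\<close> by (simp add: not_le)
    finally show False
      using min[OF \<open>B' \<in> C\<close>] by simp
  qed
  then show ?thesis
    using B by (auto simp: lower_simplices_def)
qed

text \<open>
  The lower simplices cover all points outside finitely many lower-dimensional hulls. Since these
  hulls form a null set and the union of the simplices is closed, nothing is missed.
\<close>

lemma dissection_exists:
  fixes V :: "(real^'n) set"
  assumes V: "finite V" and int: "interior (convex hull V) \<noteq> {}"
  shows "\<exists>T. dissection T (convex hull V) \<and> (\<forall>B\<in>#T. B \<subseteq> V)"
proof -
  obtain h where generic: "\<And>B w. B \<subseteq> V \<Longrightarrow> full_simplex B \<Longrightarrow> w \<in> V - B \<Longrightarrow> interpolant B h w \<noteq> h w"
    using generic_heights[OF V] by blast
  define T where "T = lower_simplices V h"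
  have T: "B \<subseteq> V" "full_simplex B" if "B \<in> T" for B
    using that by (auto simp: T_def lower_simplices_def)
  have finT: "finite T"
    using V finite_subset[of T "Pow V"] T by blast
  have comp: "compact (convex hull W)" if "W \<subseteq> V" for W
    using that V finite_subset finite_imp_compact_convex_hull by blast
  define Z where "Z = (\<Union>W\<in>{W. W \<subseteq> V \<and> interior (convex hull W) = {}}. convex hull W)"
  have "negligible Z"
    unfolding Z_def using V by (intro negligible_Union) (auto simp: negligible_convex_interior)
  have closedT: "closed (\<Union>B\<in>T. convex hull B)"
    using finT T comp by (intro closed_UN) (auto intro: compact_imp_closed)
  have cover: "x \<in> convex hull V \<Longrightarrow> x \<notin> Z \<Longrightarrow> x \<in> (\<Union>B\<in>T. convex hull B)" for x
    using lower_simplices_cover_generic[OF V, of x h] unfolding T_def Z_def by blast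
  have "interior (convex hull V) \<subseteq> (\<Union>B\<in>T. convex hull B)"
  proof (rule ccontr)
    assume "\<not> ?thesis"
    then have "interior (convex hull V) - (\<Union>B\<in>T. convex hull B) \<noteq> {}"
      by blast
    moreover have "open (interior (convex hull V) - (\<Union>B\<in>T. convex hull B))"
      using closedT by (intro open_Diff) auto
    moreover have "interior (convex hull V) - (\<Union>B\<in>T. convex hull B) \<subseteq> Z"
      using cover interior_subset by blast
    ultimately show False
      using \<open>negligible Z\<close> negligible_subset open_not_negligible by blast
  qed
  then have "closure (interior (convex hull V)) \<subseteq> (\<Union>B\<in>T. convex hull B)"
    using closedT by (rule closure_minimal)
  then have sub: "convex hull V \<subseteq> (\<Union>B\<in>T. convex hull B)"
    using convex_closure_interior[OF convex_convex_hull int] closure_subset by blast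
  have eq: "(\<Union>B\<in>T. convex hull B) = convex hull V"
    using sub T(1) hull_mono[of _ V convex] by blast
  have meas: "interior (convex hull B) \<in> lmeasurable" if "B \<in> T" for B
    using comp T that by (simp add: compact_imp_bounded lmeasurable_interior)
  have "(\<Sum>B\<in>T. measure lebesgue (convex hull B)) = (\<Sum>B\<in>T. measure lebesgue (interior (convex hull B)))"
    using comp T
    by (intro sum.cong refl measure_interior[symmetric] negligible_convex_frontier compact_imp_bounded convex_convex_hull) blast
  also have "\<dots> = measure lebesgue (\<Union>B\<in>T. interior (convex hull B))"
    (is "_ = measure lebesgue ?U")
  proof (rule measure_finite_Union[symmetric, OF finT])
    show "disjoint_family_on (\<lambda>B. interior (convex hull B)) T"
      unfolding disjoint_family_on_def
    proof (intro ballI impI equals0I)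
      fix B C x assume "B \<in> T" "C \<in> T" "B \<noteq> C" "x \<in> interior (convex hull B) \<inter> interior (convex hull C)"
      then show False
        using lower_simplices_disjoint[of V h B C x] generic unfolding T_def by blast
    qed
    show "(\<lambda>B. interior (convex hull B)) ` T \<subseteq> sets lebesgue"
      using meas fmeasurableD by blast
    show "emeasure lebesgue (interior (convex hull B)) \<noteq> \<infinity>" if "B \<in> T" for B
      using fmeasurableD2[OF meas[OF that]] by simp
  qed
  also have "\<dots> \<le> measure lebesgue (convex hull V)"
  proof (rule measure_mono_fmeasurable)
    show "?U \<subseteq> convex hull V"
      unfolding eq[symmetric] using interior_subset by blast
    show "?U \<in> sets lebesgue"
      using finT meas by (intro sets.finite_UN) (auto intro: fmeasurableD)
    show "convex hull V \<in> lmeasurable"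
      using lmeasurable_compact[OF comp[OF order_refl]] .
  qed
  finally have "dissection (mset_set T) (convex hull V)"
    using finT T eq by (simp add: dissection_def sum_unfold_sum_mset)
  then show ?thesis
    using finT T by (intro exI[of _ "mset_set T"]) auto
qed

section \<open>The lower bound for the volume\<close>

lemma sum_set_mset_le:
  fixes f :: "'a \<Rightarrow> nat"
  shows "sum f (set_mset M) \<le> (\<Sum>x\<in>#M. f x)"
proof (induction M)
  case (add x M)
  then show ?case
    by (cases "x \<in># M") (auto simp: insert_absorb)
qed auto

text \<open>
  The vertices of the refined dissection are old vertices or points inserted before, so each new point
  satisfies the hypothesis of \<open>sum_carrier_dim_ge\<close> when its turn comes.
\<close>

lemma dissection_insert_points:
  fixes T :: "(real^'n) set multiset"
  assumes "dissection T P" "finite Q" "Q \<subseteq> interior P" "Q \<inter> \<Union>(set_mset T) = {}"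
  shows "\<exists>T'. dissection T' P \<and> (\<forall>B\<in>#T'. B \<subseteq> \<Union>(set_mset T) \<union> Q)
      \<and> size T + CARD('n) * card Q \<le> size T'"
  using assms(2,3,4)
proof (induction Q)
  case empty
  then show ?case
    using assms(1) by (intro exI[of _ T]) auto
next
  case (insert p Q)
  then obtain T' where T': "dissection T' P" "\<forall>B\<in>#T'. B \<subseteq> \<Union>(set_mset T) \<union> Q"
      "size T + CARD('n) * card Q \<le> size T'"
    by auto
  have full: "\<forall>B\<in>#T'. full_simplex B"
    using T'(1) by (simp add: dissection_def)
  obtain T'' where T'': "\<forall>B\<in>#T''. full_simplex B \<and> B \<subseteq> insert p (\<Union>(set_mset T'))"
      "(\<Union>B\<in>set_mset T''. convex hull B) = (\<Union>B\<in>set_mset T'. convex hull B)"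
      "(\<Sum>B\<in>#T''. measure lebesgue (convex hull B)) = (\<Sum>B\<in>#T'. measure lebesgue (convex hull B))"
      "size T'' = size T' + (\<Sum>B\<in>#T'. carrier_dim p B)"
    using refine_at_point[OF full, of p] by auto
  have "p \<notin> \<Union>(set_mset T')"
    using T'(2) insert.hyps insert.prems by blast
  moreover have "p \<in> interior (\<Union>B\<in>set_mset T'. convex hull B)"
    using T'(1) insert.prems by (simp add: dissection_def)
  ultimately have "CARD('n) \<le> (\<Sum>B\<in>set_mset T'. carrier_dim p B)"
    using full by (intro sum_carrier_dim_ge) auto
  then have "size T' + CARD('n) \<le> size T''"
    using T''(4) sum_set_mset_le[of "carrier_dim p" T'] by linarith
  moreover have "dissection T'' P"
    using T'(1) T'' by (auto simp: dissection_def)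
  moreover have "\<forall>B\<in>#T''. B \<subseteq> \<Union>(set_mset T) \<union> insert p Q"
    using T''(1) T'(2) by blast
  ultimately show ?case
    using T'(3) insert.hyps by (intro exI[of _ T'']) auto
qed

lemma det_of_int: "det (map_matrix real_of_int A) = real_of_int (det A)"
  by (simp add: det_def map_matrix_def)

lemma map_matrix_floor:
  assumes "\<And>i j. M $ i $ j \<in> \<int>"
  shows "map_matrix real_of_int (\<chi> i j. \<lfloor>M $ i $ j\<rfloor>) = M"
  using assms by (simp add: vec_eq_iff map_matrix_def)

text \<open>
  The determinant of the edge matrix is a nonzero integer.
\<close>

lemma lattice_simplex_measure_ge:
  fixes B :: "(real^'n) set"
  assumes B: "full_simplex B" and lat: "B \<subseteq> int_lattice"
  shows "1 / fact CARD('n) \<le> measure lebesgue (convex hull B)"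
proof -
  obtain a where a: "a \<in> B"
    using B by (force simp: full_simplex_def)
  obtain f :: "'n \<Rightarrow> real^'n" where f: "bij_betw f UNIV (B - {a})"
    using enumerate_facet[OF B a] by blast
  let ?M = "\<chi> i j. f j $ i - a $ i"
  have ran: "range f = B - {a}"
    using f by (simp add: bij_betw_def)
  then have "f j \<in> int_lattice" for j
    using lat by blast
  then have "?M $ i $ j \<in> \<int>" for i j
    using a lat by (auto simp: int_lattice_def)
  then have "?M = map_matrix real_of_int (\<chi> i j. \<lfloor>?M $ i $ j\<rfloor>)"
    by (rule map_matrix_floor[symmetric])
  then have det: "det ?M = real_of_int (det (\<chi> i j. \<lfloor>?M $ i $ j\<rfloor>))"
    by (rule trans[OF arg_cong[where f=det] det_of_int])
  have vol: "measure lebesgue (convex hull B) = \<bar>det ?M\<bar> / fact CARD('n)"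
    unfolding measure_simplex[symmetric] ran using a by (simp add: insert_absorb)
  have "0 < measure lebesgue (convex hull B)"
    using B full_simplex_measure_pos_iff by (auto simp: full_simplex_def)
  then have "det ?M \<noteq> 0"
    using vol by auto
  then have "1 \<le> \<bar>det ?M\<bar>"
    unfolding det by simp
  then show ?thesis
    unfolding vol by (intro divide_right_mono) auto
qed

lemma dissection_size_bound:
  fixes T :: "(real^'n) set multiset"
  assumes T: "dissection T P" "\<forall>B\<in>#T. B \<subseteq> int_lattice" "\<forall>B\<in>#T. B \<inter> interior P = {}"
    and Q: "finite Q" "Q \<subseteq> interior P \<inter> int_lattice"
  shows "real (size T + CARD('n) * card Q) / fact CARD('n) \<le> measure lebesgue P"
proof -
  obtain T' where T': "dissection T' P" "\<forall>B\<in>#T'. B \<subseteq> \<Union>(set_mset T) \<union> Q"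
      "size T + CARD('n) * card Q \<le> size T'"
    using dissection_insert_points[OF T(1) Q(1)] Q(2) T(3) by blast
  have "real (size T + CARD('n) * card Q) / fact CARD('n) \<le> real (size T') / fact CARD('n)"
    using T'(3) by (intro divide_right_mono) (auto simp only: of_nat_le_iff, auto)
  also have "\<dots> = (\<Sum>B\<in>#T'. 1 / fact CARD('n))"
    by simp
  also have "\<dots> \<le> (\<Sum>B\<in>#T'. measure lebesgue (convex hull B))"
  proof (rule sum_mset_mono)
    fix B assume "B \<in># T'"
    then have full: "full_simplex B" and "B \<subseteq> \<Union>(set_mset T) \<union> Q"
      using T'(1,2) by (simp_all add: dissection_def)
    then have "B \<subseteq> int_lattice"
      using T(2) Q(2) by blast
    with full show "1 / fact CARD('n) \<le> measure lebesgue (convex hull B)"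
      by (rule lattice_simplex_measure_ge)
  qed
  also have "\<dots> \<le> measure lebesgue P"
    using T'(1) by (simp add: dissection_def)
  finally show ?thesis .
qed

lemma lattice_polytope_dissection:
  fixes P :: "(real^'n) set"
  assumes "P \<in> lattice_polytopes"
  shows "\<exists>T. dissection T P \<and> T \<noteq> {#} \<and> (\<forall>B\<in>#T. B \<subseteq> int_lattice) \<and> (\<forall>B\<in>#T. B \<inter> interior P = {})"
proof -
  define V where "V = {v. v extreme_point_of P}"
  have P: "polytope P" "V \<subseteq> int_lattice" "aff_dim P = int CARD('n)"
    using assms by (auto simp: lattice_polytopes_def V_def)
  have finV: "finite V"
    unfolding V_def using P(1) by (simp add: finite_polyhedron_extreme_points polytope_imp_polyhedron)
  have hull: "P = convex hull V"
    unfolding V_def using P(1) by (simp add: Krein_Milman_Minkowski polytope_imp_compact polytope_imp_convex)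
  have "affine hull P = UNIV"
    using P(3) by (simp add: affine_hull_UNIV)
  then have "interior (convex hull V) \<noteq> {}"
    by (metis P(1) hull polytope_imp_convex rel_interior_eq_empty rel_interior_interior
        affine_hull_empty empty_not_UNIV)
  then obtain T where T: "dissection T P" "\<forall>B\<in>#T. B \<subseteq> V"
    using dissection_exists[OF finV] hull by blast
  have "T \<noteq> {#}"
    using T(1) \<open>affine hull P = UNIV\<close> by (auto simp: dissection_def)
  moreover have "V \<inter> interior P = {}"
    unfolding V_def using extreme_point_not_in_interior by blast
  ultimately show ?thesis
    using T P(2) by (intro exI[of _ T]) blast
qed

lemma lattice_polytope_measure_ge:
  fixes P :: "(real^'n) set"
  assumes P: "P \<in> lattice_polytopes"
  shows "(real CARD('n) * real (lattice_count (interior P)) + 1) / fact CARD('n) \<le> measure lebesgue P"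
proof -
  obtain T where T: "dissection T P" "T \<noteq> {#}" "\<forall>B\<in>#T. B \<subseteq> int_lattice" "\<forall>B\<in>#T. B \<inter> interior P = {}"
    using lattice_polytope_dissection[OF P] by blast
  \<comment> \<open>Were the set of lattice points infinite, its cardinality would be 0, and the empty set would do.\<close>
  obtain Q where Q: "finite Q" "Q \<subseteq> interior P \<inter> int_lattice" "card Q = lattice_count (interior P)"
  proof (cases "finite (interior P \<inter> int_lattice)")
    case True
    then show ?thesis
      using that[of "interior P \<inter> int_lattice"] by (simp add: lattice_count_def)
  next
    case False
    then show ?thesis
      using that[of "{}"] by (simp add: lattice_count_def)
  qed
  have "1 \<le> size T"
    using T(2) by (metis Suc_leI nonempty_has_size One_nat_def)
  then have "real CARD('n) * real (lattice_count (interior P)) + 1 \<le> real (size T + CARD('n) * card Q)"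
    by (simp add: Q(3))
  then have "(real CARD('n) * real (lattice_count (interior P)) + 1) / fact CARD('n)
      \<le> real (size T + CARD('n) * card Q) / fact CARD('n)"
    by (intro divide_right_mono) auto
  also have "\<dots> \<le> measure lebesgue P"
    by (rule dissection_size_bound[OF T(1,3,4) Q(1,2)])
  finally show ?thesis .
qed

section \<open>Unimodular maps\<close>

lemma map_matrix_of_int_mult:
  "map_matrix real_of_int (A ** B) = map_matrix real_of_int A ** map_matrix real_of_int B"
  by (simp add: vec_eq_iff map_matrix_def matrix_matrix_mult_def)

lemma map_matrix_of_int_mat_1: "map_matrix real_of_int (mat 1) = mat 1"
  by (simp add: vec_eq_iff map_matrix_def mat_def)

lemma map_matrix_of_int_eq_iff: "map_matrix real_of_int A = map_matrix real_of_int B \<longleftrightarrow> A = B"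
  by (simp add: vec_eq_iff map_matrix_def)

text \<open>
  By Cramer's rule the entries of the inverse are quotients of integer determinants by the determinant
  of \<open>A\<close>, so they are integers when that is 1 or -1.
\<close>

lemma invertible_int_matrix_iff:
  fixes A :: "int^'n^'n"
  shows "invertible A \<longleftrightarrow> \<bar>det A\<bar> = 1"
proof
  assume "invertible A"
  then obtain B where "A ** B = mat 1"
    unfolding invertible_def by blast
  then have "det A * det B = 1"
    by (metis det_I det_mul)
  then show "\<bar>det A\<bar> = 1"
    by (auto simp: zmult_eq_1_iff)
next
  assume det: "\<bar>det A\<bar> = 1"
  let ?R = "map_matrix real_of_int A"
  have detR: "\<bar>det ?R\<bar> = 1"
    using det by (simp add: det_of_int flip: of_int_abs)
  then have "invertible ?R"
    by (auto simp: invertible_det_nz)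
  then obtain S where S: "?R ** S = mat 1" "S ** ?R = mat 1"
    unfolding invertible_def by blast
  have "S $ i $ j \<in> \<int>" for i j
  proof -
    have "?R *v column j S = column j (?R ** S)"
      by (simp add: column_def vec_eq_iff matrix_vector_mult_def matrix_matrix_mult_def)
    then have eq: "?R *v column j S = axis j 1"
      by (simp add: S column_def mat_def axis_def vec_eq_iff)
    have "det ?R \<noteq> 0"
      using detR by auto
    from iffD1[OF cramer[OF this] eq] have "column j S = (\<chi> k. det (\<chi> i l. if l = k then axis j 1 $ i else ?R $ i $ l) / det ?R)" .
    then have "S $ i $ j = det (\<chi> k l. if l = i then axis j 1 $ k else ?R $ k $ l) / det ?R"
      by (simp add: column_def vec_eq_iff)
    also have "(\<chi> k l. if l = i then axis j 1 $ k else ?R $ k $ l)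
        = map_matrix real_of_int (\<chi> k l. if l = i then axis j 1 $ k else A $ k $ l)"
      by (simp add: vec_eq_iff map_matrix_def axis_def)
    finally have *: "S $ i $ j = of_int (det (\<chi> k l. if l = i then axis j 1 $ k else A $ k $ l)) / of_int (det A)"
      by (simp only: det_of_int)
    have "det A = 1 \<or> det A = -1"
      using det by linarith
    then show ?thesis
      unfolding * by auto
  qed
  then obtain B where B: "S = map_matrix real_of_int B"
    using map_matrix_floor by metis
  have "map_matrix real_of_int (A ** B) = map_matrix real_of_int (mat 1)"
    "map_matrix real_of_int (B ** A) = map_matrix real_of_int (mat 1)"
    using S by (simp_all only: B map_matrix_of_int_mult map_matrix_of_int_mat_1)
  then have "A ** B = mat 1" "B ** A = mat 1"
    by (simp_all only: map_matrix_of_int_eq_iff)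
  then show "invertible A"
    unfolding invertible_def by blast
qed

lemma measure_unimodular_image:
  fixes A :: "int^'n^'n" and Q :: "(real^'n) set"
  assumes "invertible A" "Q \<in> lmeasurable"
  shows "measure lebesgue ((\<lambda>x. map_matrix real_of_int A *v x + b) ` Q) = measure lebesgue Q"
proof -
  have "(\<lambda>x. map_matrix real_of_int A *v x + b) ` Q = (+) b ` (*v) (map_matrix real_of_int A) ` Q"
    by (simp add: image_image add.commute)
  moreover have "\<bar>det (map_matrix real_of_int A)\<bar> = 1"
    using assms(1) by (simp add: invertible_int_matrix_iff det_of_int flip: of_int_abs)
  ultimately show ?thesis
    using measure_linear_image_finite_index[OF matrix_vector_mul_linear assms(2), of "map_matrix real_of_int A"]
    by (simp add: measure_translation matrix_of_matrix_vector_mul)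
qed

section \<open>Simplices attaining the bound\<close>

text \<open>
  The simplices attaining the bound arise from the standard simplex by replacing the origin, so their
  coordinates and volumes follow from those computed here.
\<close>

lemma bary_std_simplex:
  fixes x :: "real^'n"
  defines "B \<equiv> insert 0 (range (\<lambda>i. axis i 1))"
  shows "full_simplex B" "bary B x 0 = 1 - (\<Sum>i\<in>UNIV. x $ i)" "bary B x (axis i 1) = x $ i"
    "measure lebesgue (convex hull B) = 1 / fact CARD('n)"
proof -
  have inj: "inj (\<lambda>i::'n. axis i (1::real))"
    by (auto simp: inj_def axis_eq_axis)
  have "(\<chi> i j. axis j 1 $ i - (0::real^'n) $ i) = mat 1"
    by (simp add: vec_eq_iff axis_def mat_def)
  then show meas: "measure lebesgue (convex hull B) = 1 / fact CARD('n)"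
    using measure_simplex[of 0 "\<lambda>i::'n. axis i 1"] by (simp add: B_def)
  have n0: "0 \<notin> range (\<lambda>i::'n. axis i (1::real))"
    by (auto simp: axis_eq_0_iff)
  then have "card B = Suc CARD('n)"
    by (simp add: B_def card_image[OF inj])
  then show full: "full_simplex B"
    by (simp add: full_simplex_measure_pos_iff meas)
  define u where "u b = (if b = 0 then 1 - (\<Sum>i\<in>UNIV. x $ i) else x \<bullet> b)" for b
  have u_axis: "u (axis i 1) = x $ i" for i
    by (simp add: u_def axis_eq_0_iff inner_axis)
  have sums: "sum g B = g 0 + (\<Sum>i\<in>UNIV. g (axis i 1))" for g :: "real^'n \<Rightarrow> 'b::ab_group_add"
    using n0 by (simp add: B_def sum.reindex[OF inj])
  have "sum u B = 1"
    by (simp add: sums u_axis) (simp add: u_def)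
  moreover have "(\<Sum>b\<in>B. u b *\<^sub>R b) = x"
    using basis_expansion[of x] by (simp add: sums u_axis scalar_mult_eq_scaleR)
  ultimately have bary: "bary B x b = u b" if "b \<in> B" for b
    using that by (rule bary_unique[OF full])
  show "bary B x 0 = 1 - (\<Sum>i\<in>UNIV. x $ i)"
    using bary[of 0] by (simp add: B_def u_def)
  show "bary B x (axis i 1) = x $ i"
    using bary[of "axis i 1"] u_axis by (simp add: B_def)
qed

definition extremal_vertices :: "nat \<Rightarrow> (real^'n) set" where
  "extremal_vertices l = insert (- real l *\<^sub>R (\<Sum>i\<in>UNIV. axis i 1)) (range (\<lambda>i. axis i 1))"

lemma sum_axis_nth: "(\<Sum>i\<in>UNIV. axis i (1::real)) $ j = 1"
  by (simp add: axis_def)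

lemma extremal_simplex:
  fixes l :: nat
  defines "B \<equiv> extremal_vertices l :: (real^'n) set"
  shows "full_simplex B"
    and "measure lebesgue (convex hull B) = (real CARD('n) * real l + 1) / fact CARD('n)"
    and "x \<in> interior (convex hull B) \<longleftrightarrow>
      (\<Sum>i\<in>UNIV. x $ i) < 1 \<and> (\<forall>i. 0 < x $ i + real l * (1 - (\<Sum>i\<in>UNIV. x $ i)) / (real CARD('n) * real l + 1))"
proof -
  let ?w = "- real l *\<^sub>R (\<Sum>i\<in>UNIV. axis i 1) :: real^'n"
  let ?S = "insert 0 (range (\<lambda>i. axis i 1)) :: (real^'n) set"
  have "0 \<notin> range (\<lambda>i::'n. axis i (1::real))"
    by (auto simp: axis_eq_0_iff)
  then have B: "B = insert ?w (?S - {0})"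
    by (simp add: B_def extremal_vertices_def)
  have w: "?w $ i = - real l" for i
    using sum_axis_nth[of i] by simp
  have pos: "0 < real CARD('n) * real l + 1"
    by (simp add: add_nonneg_pos)
  have w0: "bary ?S ?w 0 = real CARD('n) * real l + 1"
    unfolding bary_std_simplex(2) w by simp
  then have nz: "bary ?S ?w 0 \<noteq> 0"
    using pos by simp
  have S: "full_simplex ?S" "0 \<in> ?S"
    by (simp_all add: bary_std_simplex)
  show full: "full_simplex B"
    unfolding B by (rule full_simplex_replace_vertex(1)[OF S nz])
  show "measure lebesgue (convex hull B) = (real CARD('n) * real l + 1) / fact CARD('n)"
    unfolding B measure_replace_vertex[OF S] w0 bary_std_simplex(4) using pos by simp
  have x0: "bary ?S x 0 = 1 - (\<Sum>i\<in>UNIV. x $ i)"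
    by (rule bary_std_simplex(2))
  define t where "t = (1 - (\<Sum>i\<in>UNIV. x $ i)) / (real CARD('n) * real l + 1)"
  have bw: "bary B x ?w = t"
    unfolding B bary_replace_vertex(1)[OF S nz] w0 x0 t_def ..
  have "bary B x (axis i 1) = bary ?S x (axis i 1) - bary ?S x 0 / bary ?S ?w 0 * bary ?S ?w (axis i 1)" for i
    unfolding B by (rule bary_replace_vertex(2)[OF S nz]) (simp add: axis_eq_0_iff)
  then have ba: "bary B x (axis i 1) = x $ i + real l * t" for i
    unfolding w0 x0 bary_std_simplex(3) w t_def by simp
  have "x \<in> interior (convex hull B) \<longleftrightarrow> 0 < bary B x ?w \<and> (\<forall>i. 0 < bary B x (axis i 1))"
    unfolding mem_interior_simplex_iff[OF full] by (auto simp: B_def extremal_vertices_def)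
  also have "\<dots> \<longleftrightarrow> (\<Sum>i\<in>UNIV. x $ i) < 1 \<and> (\<forall>i. 0 < x $ i + real l * t)"
    unfolding bw ba using pos by (simp add: t_def zero_less_divide_iff)
  finally show "x \<in> interior (convex hull B) \<longleftrightarrow>
      (\<Sum>i\<in>UNIV. x $ i) < 1 \<and> (\<forall>i. 0 < x $ i + real l * (1 - (\<Sum>i\<in>UNIV. x $ i)) / (real CARD('n) * real l + 1))"
    by (simp add: t_def)
qed

text \<open>
  The coordinates \<open>x $ i + l t\<close> of an interior point at the unit vectors lie strictly between 0 and 1,
  and the entries of an integral point differ from them by the common amount \<open>l t\<close>. Hence all entries
  are equal to one integer \<open>m\<close>. Positivity of the coordinate \<open>t\<close> at the remaining vertex forces \<open>m \<le> 0\<close>,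
  and positivity at the unit vectors forces \<open>m > -l\<close>.
\<close>

lemma extremal_simplex_lattice_points:
  fixes l :: nat
  shows "interior (convex hull (extremal_vertices l)) \<inter> int_lattice = (\<lambda>k. (\<chi> i. - real k) :: real^'n) ` {..<l}"
proof -
  let ?n = "real CARD('n)"
  have pos: "0 < ?n * real l + 1"
    by (simp add: add_nonneg_pos)
  have "x \<in> (\<lambda>k. (\<chi> i. - real k) :: real^'n) ` {..<l}"
    if x: "x \<in> interior (convex hull (extremal_vertices l)) \<inter> int_lattice" for x :: "real^'n"
  proof -
    define s where "s = (\<Sum>i\<in>UNIV. x $ i)"
    define t where "t = (1 - s) / (?n * real l + 1)"
    have "s < 1" and y: "0 < x $ i + real l * t" for i
      using x extremal_simplex(3)[of x l] by (auto simp: s_def t_def)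
    then have "0 < t"
      using pos by (simp add: t_def)
    have "(\<Sum>i\<in>UNIV. x $ i + real l * t) = s + ?n * real l * t"
      by (simp add: sum.distrib s_def)
    also have "\<dots> = 1 - t"
      using pos by (simp add: t_def field_simps)
    finally have sum_y: "(\<Sum>i\<in>UNIV. x $ i + real l * t) = 1 - t" .
    have y1: "x $ i + real l * t < 1" for i
    proof -
      have "x $ i + real l * t \<le> (\<Sum>i\<in>UNIV. x $ i + real l * t)"
        using y by (intro member_le_sum) (auto intro: less_imp_le)
      then show ?thesis
        using sum_y \<open>0 < t\<close> by linarith
    qed
    define z where "z i = \<lfloor>x $ i\<rfloor>" for i
    have z: "x $ i = of_int (z i)" for i
      using x by (simp add: int_lattice_def z_def)
    define m where "m = z undefined"
    have "z i = m" for i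
      using y[of i] y1[of i] y[of undefined] y1[of undefined] unfolding z m_def by linarith
    then have xm: "x $ i = of_int m" for i
      using z by simp
    have s: "s = ?n * of_int m"
      by (simp add: s_def xm)
    have "m \<le> 0"
    proof (rule ccontr)
      assume "\<not> m \<le> 0"
      then have "?n * 1 \<le> ?n * of_int m"
        by (intro mult_left_mono) auto
      moreover have "1 \<le> ?n"
        by (simp add: Suc_leI)
      ultimately show False
        using \<open>s < 1\<close> s by linarith
    qed
    moreover have "- int l < m"
    proof -
      have "of_int m + real l * t = (of_int m + real l) / (?n * real l + 1)"
        using pos by (simp add: t_def s field_simps)
      then have "0 < of_int m + real l"
        using y[of undefined] pos by (simp add: xm zero_less_divide_iff)
      then show ?thesis
        by linarith
    qed
    ultimately have "nat (- m) < l" "x = (\<chi> i. - real (nat (- m)))"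
      by (simp_all add: vec_eq_iff xm)
    then show ?thesis
      by blast
  qed
  moreover have "x \<in> interior (convex hull (extremal_vertices l)) \<inter> int_lattice"
    if "x \<in> (\<lambda>k. (\<chi> i. - real k) :: real^'n) ` {..<l}" for x :: "real^'n"
  proof -
    from that obtain k where k: "k < l" "x = (\<chi> i. - real k)"
      by blast
    have s: "(\<Sum>i\<in>UNIV. x $ i) = - (?n * real k)"
      by (simp add: k)
    have "0 < (real l - real k) / (?n * real l + 1)"
      using k pos by simp
    also have "\<dots> = - real k + real l * (1 + ?n * real k) / (?n * real l + 1)"
      using pos by (simp add: field_simps)
    finally have "0 < x $ i + real l * (1 - (\<Sum>i\<in>UNIV. x $ i)) / (?n * real l + 1)" for i
      unfolding s by (simp add: k)
    moreover have "(\<Sum>i\<in>UNIV. x $ i) < 1"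
      unfolding s by (rule le_less_trans[of _ 0]) simp_all
    ultimately have "x \<in> interior (convex hull (extremal_vertices l))"
      using extremal_simplex(3)[of x l] by blast
    moreover have "x \<in> int_lattice"
      by (simp add: int_lattice_def k)
    ultimately show ?thesis
      by blast
  qed
  ultimately show ?thesis
    by blast
qed

lemma extremal_simplex_lattice_polytope:
  "convex hull (extremal_vertices l) \<in> (lattice_polytopes :: (real^'n) set set)"
proof -
  let ?B = "extremal_vertices l :: (real^'n) set"
  have B: "full_simplex ?B"
    by (rule extremal_simplex(1))
  have "?B \<subseteq> int_lattice"
    by (auto simp: extremal_vertices_def int_lattice_def axis_def)
  then have "{v. v extreme_point_of convex hull ?B} \<subseteq> int_lattice"
    using extreme_point_of_convex_hull by blast
  moreover have "aff_dim (convex hull ?B) = int CARD('n)"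
    using B affine_independent_iff_card[of ?B] by (simp add: aff_dim_convex_hull full_simplex_def)
  moreover have "polytope (convex hull ?B)"
    using full_simplex_finite[OF B] polytope_def by blast
  ultimately show ?thesis
    by (simp add: lattice_polytopes_def)
qed

lemma extremal_simplex_lattice_count:
  "lattice_count (interior (convex hull (extremal_vertices l :: (real^'n) set))) = l"
proof -
  have "inj_on (\<lambda>k. (\<chi> i. - real k) :: real^'n) {..<l}"
    by (auto simp: inj_on_def vec_eq_iff)
  then show ?thesis
    by (simp add: lattice_count_def extremal_simplex_lattice_points card_image)
qed

lemma S1_simplex_eq: "S1_simplex = convex hull (extremal_vertices 1)"
  by (simp add: S1_simplex_def extremal_vertices_def)

section \<open>Equality for one interior lattice point\<close>

text \<open>
  Subdividing at \<open>p\<close> gives \<open>n + 1\<close> lattice simplices of total volume \<open>(n + 1)/n!\<close>, so each has the minimal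
  volume \<open>1/n!\<close>. Equal volumes make \<open>p\<close> the centroid, and volume \<open>1/n!\<close> makes the vectors from \<open>p\<close> to all
  vertices but one a lattice basis; the centroid relation then places the remaining vertex at minus
  the sum of the basis.
\<close>

lemma unimodularly_isomorphic_S1_simplex:
  fixes B :: "(real^'n) set"
  assumes B: "full_simplex B" "B \<subseteq> int_lattice"
    and p: "p \<in> interior (convex hull B)" "p \<in> int_lattice"
    and vol: "measure lebesgue (convex hull B) = (real CARD('n) + 1) / fact CARD('n)"
  shows "unimodularly_isomorphic (convex hull B) S1_simplex"
proof -
  note fin = full_simplex_finite[OF B(1)]
  have card: "card B = CARD('n) + 1"
    using B(1) by (simp add: full_simplex_def)
  have pos: "0 < bary B p b" if "b \<in> B" for b
    using that p(1) mem_interior_simplex_iff[OF B(1)] by blast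
  have star: "measure lebesgue (convex hull (insert p (B - {b}))) = bary B p b * ((real CARD('n) + 1) / fact CARD('n))"
    if "b \<in> B" for b
    using measure_replace_vertex[OF B(1) that, of p] pos[OF that] by (simp add: vol)
  have ge: "1 / (real CARD('n) + 1) \<le> bary B p b" if "b \<in> B" for b
  proof -
    have "full_simplex (insert p (B - {b}))"
      using full_simplex_replace_vertex(1)[OF B(1) that] pos[OF that] by simp
    then have "1 / fact CARD('n) \<le> measure lebesgue (convex hull (insert p (B - {b})))"
      using B(2) p(2) by (intro lattice_simplex_measure_ge) auto
    then have "1 \<le> bary B p b * (real CARD('n) + 1)"
      unfolding star[OF that] by (simp add: field_simps)
    then show ?thesis
      by (simp add: field_simps)
  qed
  have "(\<Sum>b\<in>B. bary B p b - 1 / (real CARD('n) + 1)) = 0"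
    using bary_sum[OF B(1), of p] by (simp add: sum_subtractf card)
  then have bary: "bary B p b = 1 / (real CARD('n) + 1)" if "b \<in> B" for b
    using sum_nonneg_eq_0_iff[OF fin, of "\<lambda>b. bary B p b - 1 / (real CARD('n) + 1)"] ge that by simp
  obtain a where a: "a \<in> B"
    using card by fastforce
  obtain f :: "'n \<Rightarrow> real^'n" where f: "bij_betw f UNIV (B - {a})"
    using enumerate_facet[OF B(1) a] by blast
  have ran: "range f = B - {a}"
    using f by (simp add: bij_betw_def)
  let ?M = "\<chi> i j. f j $ i - p $ i"
  have "f j \<in> int_lattice" for j
    using ran B(2) by blast
  then have "?M $ i $ j \<in> \<int>" for i j
    using p(2) by (auto simp: int_lattice_def)
  then have M: "map_matrix real_of_int (\<chi> i j. \<lfloor>?M $ i $ j\<rfloor>) = ?M"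
    by (rule map_matrix_floor)
  let ?A = "\<chi> i j. \<lfloor>?M $ i $ j\<rfloor>"
  have "\<bar>det ?M\<bar> / fact CARD('n) = 1 / fact CARD('n)"
    unfolding measure_simplex[symmetric] ran star[OF a] bary[OF a] by simp
  then have "\<bar>det ?M\<bar> = 1"
    by simp
  then have "\<bar>real_of_int (det ?A)\<bar> = 1"
    unfolding det_of_int[symmetric] M .
  then have inv: "invertible ?A"
    unfolding invertible_int_matrix_iff by linarith
  have Mf: "?M *v axis j 1 = f j - p" for j
    by (simp add: matrix_vector_mult_basis column_def vec_eq_iff)
  have "p = (\<Sum>b\<in>B. (1 / (real CARD('n) + 1)) *\<^sub>R b)"
    using bary_combination[OF B(1), of p] bary by simp
  then have "(real CARD('n) + 1) *\<^sub>R p = \<Sum>B"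
    by (simp flip: scaleR_sum_right)
  also have "\<dots> = a + (\<Sum>j\<in>UNIV. f j)"
    using sum.remove[OF fin a, of "\<lambda>b. b"] sum.reindex_bij_betw[OF f, of "\<lambda>b. b"] by simp
  finally have "a = (real CARD('n) + 1) *\<^sub>R p - (\<Sum>j\<in>UNIV. f j)"
    by simp
  also have "\<dots> = p - (\<Sum>j\<in>UNIV. f j - p)"
    by (simp add: sum_subtractf scaleR_left_distrib sum_constant_scaleR del: sum_constant)
  also have "(\<Sum>j\<in>UNIV. f j - p) = ?M *v (\<Sum>j\<in>UNIV. axis j 1)"
    unfolding linear_sum[OF matrix_vector_mul_linear] by (simp only: Mf)
  finally have Ma: "?M *v (- (\<Sum>j\<in>UNIV. axis j 1)) + p = a"
    by (simp add: linear_neg[OF matrix_vector_mul_linear])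
  let ?E = "insert (- (\<Sum>i\<in>UNIV. axis i 1)) (range (\<lambda>i. axis i 1)) :: (real^'n) set"
  have "(+) p ` (*v) ?M ` ?E = insert a (range f)"
    using Ma Mf by (simp add: image_image add.commute)
  also have "\<dots> = B"
    using ran a by auto
  finally have "convex hull B = (+) p ` (*v) ?M ` S1_simplex"
    unfolding S1_simplex_def
    by (simp only: convex_hull_linear_image[OF matrix_vector_mul_linear] flip: convex_hull_translation)
  then have "convex hull B = (\<lambda>x. map_matrix real_of_int ?A *v x + p) ` S1_simplex"
    unfolding M by (simp add: image_image add.commute)
  then show ?thesis
    unfolding unimodularly_isomorphic_def using inv p(2) by blast
qed

text \<open>
  The volume leaves room for \<open>n + 1\<close> simplices after inserting the interior lattice point, and the
  insertion adds \<open>n\<close>; so the initial dissection is a single simplex.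
\<close>

lemma equality_imp_unimodularly_isomorphic:
  fixes P :: "(real^'n) set"
  assumes P: "P \<in> lattice_polytopes" and one: "lattice_count (interior P) = 1"
    and vol: "measure lebesgue P = (real CARD('n) + 1) / fact CARD('n)"
  shows "unimodularly_isomorphic P S1_simplex"
proof -
  obtain T where T: "dissection T P" "T \<noteq> {#}" "\<forall>B\<in>#T. B \<subseteq> int_lattice" "\<forall>B\<in>#T. B \<inter> interior P = {}"
    using lattice_polytope_dissection[OF P] by blast
  obtain p where p: "interior P \<inter> int_lattice = {p}"
    using one unfolding lattice_count_def by (rule card_1_singletonE)
  then have "real (size T + CARD('n) * card {p}) / fact CARD('n) \<le> (real CARD('n) + 1) / fact CARD('n)"
    using dissection_size_bound[OF T(1,3,4), of "{p}"] unfolding vol by simp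
  then have "real (size T) \<le> 1"
    by (simp add: divide_le_cancel)
  then have "size T = 1"
    using T(2) by (metis One_nat_def Suc_leI le_antisym nonempty_has_size of_nat_le_1_iff)
  then obtain B where B: "T = {#B#}"
    using size_1_singleton_mset by blast
  then have "full_simplex B" "convex hull B = P" "B \<subseteq> int_lattice"
    using T by (simp_all add: dissection_def)
  then show ?thesis
    using unimodularly_isomorphic_S1_simplex[of B p] p vol by auto
qed

theorem theorem1p2:
  shows "(\<forall>P \<in> (lattice_polytopes :: (real ^ 'n) set set).
            measure lebesgue P \<ge>
              (real CARD('n) * real (lattice_count (interior P)) + 1) / fact CARD('n))
       \<and> (\<forall>l :: nat. \<exists>P \<in> (lattice_polytopes :: (real ^ 'n) set set).
            lattice_count (interior P) = l \<and>
            measure lebesgue P = (real CARD('n) * real l + 1) / fact CARD('n))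
       \<and> (\<forall>P \<in> (lattice_polytopes :: (real ^ 'n) set set).
            lattice_count (interior P) = 1 \<longrightarrow>
            (measure lebesgue P =
               (real CARD('n) * real (lattice_count (interior P)) + 1) / fact CARD('n)
             \<longleftrightarrow> unimodularly_isomorphic P S1_simplex))"
proof (intro conjI ballI allI impI)
  fix P :: "(real^'n) set" assume "P \<in> lattice_polytopes"
  then show "(real CARD('n) * real (lattice_count (interior P)) + 1) / fact CARD('n) \<le> measure lebesgue P"
    by (rule lattice_polytope_measure_ge)
next
  fix l :: nat
  show "\<exists>P \<in> (lattice_polytopes :: (real ^ 'n) set set).
      lattice_count (interior P) = l \<and> measure lebesgue P = (real CARD('n) * real l + 1) / fact CARD('n)"
    using extremal_simplex_lattice_polytope extremal_simplex_lattice_count extremal_simplex(2) by blast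
next
  fix P :: "(real^'n) set"
  assume P: "P \<in> lattice_polytopes" and one: "lattice_count (interior P) = 1"
  have S1: "measure lebesgue (S1_simplex :: (real^'n) set) = (real CARD('n) + 1) / fact CARD('n)"
    using extremal_simplex(2)[of 1, where 'n='n] by (simp add: S1_simplex_eq)
  have "(S1_simplex :: (real^'n) set) \<in> lmeasurable"
    unfolding S1_simplex_eq using full_simplex_finite[OF extremal_simplex(1)]
    by (intro lmeasurable_compact finite_imp_compact_convex_hull)
  then have "measure lebesgue P = (real CARD('n) + 1) / fact CARD('n)" if "unimodularly_isomorphic P S1_simplex"
    using that measure_unimodular_image S1 unfolding unimodularly_isomorphic_def by metis
  then show "measure lebesgue P = (real CARD('n) * real (lattice_count (interior P)) + 1) / fact CARD('n)
      \<longleftrightarrow> unimodularly_isomorphic P S1_simplex"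
    using equality_imp_unimodularly_isomorphic[OF P one] one by auto
qed

end
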